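(* Let $a,m\ge 2$ and $\tau=12\cdots(m-1)m^a$. Let $y=A(x,0)=\sum_{n\ge 0}\big(\sum_{\pi\in NC_n}q^{\mu_\tau(\pi)}\big)x^n$ denote the generating function counting members of $NC_n$ for $n\ge 0$ according to the number of occurrences of the subword $\tau$. Then $y$ satisfies the polynomial equation $$xy^2-y+1+(q-1)x^{a+m-2}y^{m-1}(y-1)=0.$$ More generally, the generating function $\sum_{n\ge 0}\big(\sum_{\pi\in NC_n}v^{\mathrm{rep}(\pi)}q^{\mu_\tau(\pi)}\big)x^n$ counting members of $NC_n$ jointly according to the smallest repeated letter and the number of occurrences of $\tau$ is given by $$vA(x,0,v)+\frac{1}{1-x}\qquad\text{if } a=2,$$ and by $$vA(x,0,v)+\frac{1}{1-x}+\frac{v^2x^aC_{a-1}-v^2x^2}{1-vx}+v\sum_{i=2}^{a-1}C_ix^i+(v-1)\sum_{n\ge 2}\sum_{j=r}^{n-1}C_{n-j}v^jx^n\qquad\text{if } a\ge 3,$$ where $r=\max\{1,n-a+2\}$ and $$A(x,0,v)=\frac{(y-1)(A(x,vx)-y)}{v}-M(x,0,v)+\frac{(q-1)v^{m-1}x^{a+m-2}(y-1)}{1-vx},$$ with $A(x,u)$ given by $$A(x,u)=\frac{x-u}{xy-u}\biggl(\frac{x^aC_{a-1}}{(1-u)(1-x)}+\frac{(1-q)x^{a-1}\big(u^m(1-x)-x^m(1-u)\big)(y-1)}{(1-u)(1-x)(x-u)}+\frac{x(y-1)}{x-u}A(x,x)-M(x,u,1)+L(x,u)\biggr),$$ in which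 $$A(x,x)=\frac{(q-1)x^{a-2}\big((xy)^m(1-x)-x^m(1-xy)\big)}{(1-x)(1-xy)}-M(x,xy,1)+\frac{x^aC_{a-1}}{(1-x)(1-xy)}+L(x,xy).$$
   Context: A set partition of $[n]=\{1,\dots,n\}$ with blocks $B_1,\dots,B_k$ ordered so that $\min B_1<\cdots<\min B_k$ is represented by its canonical sequential form $\pi=\pi_1\cdots\pi_n$, where $i\in B_{\pi_i}$ for each $i$. It is non-crossing if $\pi$ contains no (not necessarily consecutive) subsequence of the form $a\,b\,a\,b$ with $a<b$. $NC_n$ denotes the set of non-crossing partitions of $[n]$, identified with their canonical sequential forms ($NC_0$ consists of the empty partition). $C_n=\frac1{n+1}\binom{2n}{n}$. An occurrence of a word $\tau=\tau_1\cdots\tau_k$ as a subword in a sequence $\sigma_1\cdots\sigma_n$ is an index $i\in[n-k+1]$ such that the string of consecutive letters $\sigma_i\cdots\sigma_{i+k-1}$ is order-isomorphic to $\tau$ (same relative order, including equalities). $\mu_\tau(\pi)$ denotes the number of occurrences of $\tau$ in $\pi$. Here $\tau=12\cdots(m-1)m^a$, i.e. $1,2,\dots,m-1$ followed by $a$ copies of $m$. For $\pi\in NC_n$ other than $12\cdots n$, $\mathrm{rep}(\pi)$ is the smallest letter occurring at least twice in $\pi$; $\mathrm{rep}(12\cdots n)=0$ (including $n=0$). $NC_{n,i}$, $1\le i\le n-1$, is the set of $\pi\in NC_n$ with smallest repeated letter $i$. For $\ell\ge 0$, $\mu_\tau^{(\ell)}(\pi)$ is the number of occurrences of $\tau$ in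 the sequence $12\cdots\ell(\pi+\ell)$, where $\pi+\ell$ is obtained by adding $\ell$ to each entry of $\pi$. Define $a^{(\ell)}(n,i)=\sum_{\pi\in NC_{n,i}}q^{\mu_\tau^{(\ell)}(\pi)}$ for $n\ge2$, $1\le i\le n-1$, and $a^{(\ell)}(n)=\sum_{\pi\in NC_n}q^{\mu_\tau^{(\ell)}(\pi)}$ for $n\ge 1$, with $a^{(\ell)}(0)=1$. Define the formal power series $$A(x,u)=\sum_{n\ge0}\sum_{\ell\ge0}a^{(\ell)}(n)u^\ell x^n,\qquad A(x,u,v)=\sum_{n\ge a}\sum_{\ell\ge0}\sum_{i=1}^{n-a+1}a^{(\ell)}(n,i)u^\ell v^{i-1}x^n.$$ (So $A(x,0)$ is $A(x,u)$ at $u=0$, $A(x,vx)$ is $A(x,u)$ at $u=vx$, and so on.) Further, $L(x,u)=\frac{1}{1-u}\sum_{j=0}^{a-1}C_jx^j$, and $M(x,u,v)=0$ if $a=2$, while $M(x,u,v)=\frac{x}{(1-u)(1-vx)}\sum_{j=0}^{a-3}\sum_{i=1}^{a-2-j}C_iC_jx^{i+j}$ if $a\ge3$. *)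

theory Defs
  imports "HOL-Library.Disjoint_Sets" "HOL-Computational_Algebra.Computational_Algebra"
begin

definition block_of :: "nat set set \<Rightarrow> nat \<Rightarrow> nat set" where
  "block_of P i = (THE B. B \<in> P \<and> i \<in> B)"

text \<open>The blocks are numbered from 1 in the order of their minima, so the number of a block \<open>B\<close>
  is the number of blocks whose minimum does not exceed \<open>Min B\<close>.\<close>

definition canonical_form :: "nat \<Rightarrow> nat set set \<Rightarrow> nat list" where
  "canonical_form n P = map (\<lambda>i. card {B \<in> P. Min B \<le> Min (block_of P i)}) [1..<n+1]"

definition non_crossing :: "nat list \<Rightarrow> bool" where
  "non_crossing w \<longleftrightarrow> \<not> (\<exists>i j k l. i < j \<and> j < k \<and> k < l \<and> l < length w \<and>
     w ! i = w ! k \<and> w ! j = w ! l \<and> w ! i < w ! j)"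

definition NC :: "nat \<Rightarrow> nat list set" where
  "NC n = {canonical_form n P |P. partition_on {1..n} P \<and> non_crossing (canonical_form n P)}"

definition order_isomorphic :: "nat list \<Rightarrow> nat list \<Rightarrow> bool" where
  "order_isomorphic s t \<longleftrightarrow> length s = length t \<and>
     (\<forall>i<length t. \<forall>j<length t. (s ! i < s ! j \<longleftrightarrow> t ! i < t ! j) \<and> (s ! i = s ! j \<longleftrightarrow> t ! i = t ! j))"

text \<open>Occurrences of \<open>t\<close> in \<open>s\<close> as a string of consecutive letters; positions are counted from 0.\<close>

definition occurrences :: "nat list \<Rightarrow> nat list \<Rightarrow> nat" where
  "occurrences t s =
     card {i. i + length t \<le> length s \<and> order_isomorphic (take (length t) (drop i s)) t}"

definition pat :: "nat \<Rightarrow> nat \<Rightarrow> nat list" where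
  "pat a m = [1..<m] @ replicate a m"

definition rep :: "nat list \<Rightarrow> nat" where
  "rep w = (if w = [1..<length w + 1] then 0 else (LEAST c. 2 \<le> count_list w c))"

definition occurrences_shift :: "nat list \<Rightarrow> nat \<Rightarrow> nat list \<Rightarrow> nat" where
  "occurrences_shift t l w = occurrences t ([1..<l+1] @ map (\<lambda>c. c + l) w)"

text \<open>The division is exact.\<close>

definition catalan :: "nat \<Rightarrow> nat" where
  "catalan n = (2 * n choose n) div (n + 1)"

text \<open>The coefficients lie in \<open>\<int>[q][v]\<close>, series in \<open>x\<close> are power series over this ring,
  and series in \<open>x\<close> and \<open>u\<close> are power series in \<open>u\<close> whose coefficients are series in \<open>x\<close>.
  Identities with denominators are read in the field of fractions of this last integral domain,
  where none of the denominators used (such as \<open>x * y - u\<close>, \<open>x - u\<close>, \<open>1 - v * x\<close>) is zero.\<close>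

type_synonym qv = "int poly poly"
type_synonym series_x = "qv fps"
type_synonym series_xu = "qv fps fps"
type_synonym frac_xu = "qv fps fps fract"

definition q_var :: qv where "q_var = [:[:0, 1:]:]"

definition v_var :: qv where "v_var = [:0, 1:]"

definition of_series_x :: "series_x \<Rightarrow> frac_xu" where
  "of_series_x f = to_fract (fps_const f)"

text \<open>Substitution of a series \<open>w\<close> in \<open>x\<close> without constant term for \<open>u\<close>. The sum converges in the
  \<open>x\<close>-adic topology.\<close>

definition subst_u :: "series_xu \<Rightarrow> series_x \<Rightarrow> series_x" where
  "subst_u F w = (\<Sum>l. fps_nth F l * w ^ l)"

definition dist_rep :: "nat \<Rightarrow> nat \<Rightarrow> nat \<Rightarrow> nat \<Rightarrow> nat \<Rightarrow> qv" where
  "dist_rep a m l n i = (\<Sum>w\<in>{w \<in> NC n. rep w = i}. q_var ^ occurrences_shift (pat a m) l w)"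

definition dist_total :: "nat \<Rightarrow> nat \<Rightarrow> nat \<Rightarrow> nat \<Rightarrow> qv" where
  "dist_total a m l n =
     (if n = 0 then 1 else (\<Sum>w\<in>NC n. q_var ^ occurrences_shift (pat a m) l w))"

definition A_xu :: "nat \<Rightarrow> nat \<Rightarrow> series_xu" where
  "A_xu a m = Abs_fps (\<lambda>l. Abs_fps (\<lambda>n. dist_total a m l n))"

definition A_xuv :: "nat \<Rightarrow> nat \<Rightarrow> series_xu" where
  "A_xuv a m = Abs_fps (\<lambda>l. Abs_fps (\<lambda>n.
     if n \<ge> a then (\<Sum>i=1..n-a+1. dist_rep a m l n i * v_var ^ (i - 1)) else 0))"

definition occ_gf :: "nat \<Rightarrow> nat \<Rightarrow> series_x" where
  "occ_gf a m = Abs_fps (\<lambda>n. \<Sum>w\<in>NC n. q_var ^ occurrences (pat a m) w)"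

definition joint_gf :: "nat \<Rightarrow> nat \<Rightarrow> series_x" where
  "joint_gf a m = Abs_fps (\<lambda>n. \<Sum>w\<in>NC n. v_var ^ rep w * q_var ^ occurrences (pat a m) w)"

definition L_fun :: "nat \<Rightarrow> 'f::field \<Rightarrow> 'f \<Rightarrow> 'f" where
  "L_fun a x u = 1 / (1 - u) * (\<Sum>j=0..a-1. of_nat (catalan j) * x ^ j)"

definition M_fun :: "nat \<Rightarrow> 'f::field \<Rightarrow> 'f \<Rightarrow> 'f \<Rightarrow> 'f" where
  "M_fun a x u v = (if a = 2 then 0 else
     x / ((1 - u) * (1 - v * x)) *
       (\<Sum>j=0..a-3. \<Sum>i=1..a-2-j. of_nat (catalan i * catalan j) * x ^ (i + j)))"

text \<open>For \<open>n \<ge> 2\<close>, truncated subtraction gives \<open>max 1 (n + 2 - a) = max {1, n - a + 2}\<close>, where the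
  right-hand side is computed in the integers.\<close>

definition tail_series :: "nat \<Rightarrow> series_x" where
  "tail_series a = Abs_fps (\<lambda>n. if n \<ge> 2 then
     (\<Sum>j=max 1 (n + 2 - a)..n-1. of_nat (catalan (n - j)) * v_var ^ j) else 0)"

end

theory Submission
  imports Defs "HOL-Library.Sublist"
begin

text \<open>Cut a nonempty non-crossing word before the second occurrence of its first letter: this writes it
  as \<open>1 (\<alpha> + 1) \<beta>'\<close>, where \<open>\<alpha>\<close> is an arbitrary non-crossing word and \<open>\<beta>'\<close> is an arbitrary one \<open>\<beta>\<close>
  whose letters other than 1 are shifted past those of \<open>\<alpha>\<close>. If \<open>\<alpha>\<close> and \<open>\<beta>\<close> are nonempty, there is a
  descent at the cut, which no occurrence of the weakly increasing pattern can straddle; if \<open>\<alpha>\<close> is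
  empty, then behind a prefix \<open>1 2 ... l\<close> exactly one new occurrence arises if and only if
  \<open>l \<ge> m - 1\<close> and \<open>\<beta>\<close> starts with \<open>a - 1\<close> ones. For the coefficient \<open>A\<^sub>l\<close> of \<open>u ^ l\<close> in \<open>A(x, u)\<close> this gives
  \<open>A\<^sub>l = 1 + x y A\<^bsub>l+1\<^esub> + [l \<ge> m - 1] c\<close> with \<open>c = (q - 1) x ^ (a - 1) (y - 1)\<close>, that is
  \<open>(x y - u) A(x, u) = x y\<^sup>2 - u / (1 - u) - c u ^ m / (1 - u)\<close>.
  The substitution \<open>u = x y\<close> yields the equation of \<open>y\<close>, and \<open>u = x\<close> yields \<open>A(x, x)\<close>. A word with
  smallest repeated letter \<open>i\<close> is \<open>1 ... (i - 1)\<close> followed by a shifted word in which 1 is repeated, so the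
  joint distribution is obtained at \<open>u = v x\<close>. The terms \<open>L\<close> and \<open>M\<close> only collect words too short to
  contain the pattern, and telescope by the Catalan recurrence.\<close>

section \<open>Non-crossing words\<close>

text \<open>The canonical forms of all lengths at once. Restricted growth is stated through the
  letter sets of prefixes because these behave well under the letter shifts of the
  decomposition.\<close>

definition nc_words :: "nat list set" where
  "nc_words = {w. (\<forall>k. \<exists>M. set (take k w) = {1..M}) \<and> non_crossing w}"

lemma subseq_Cons_iff_nth:
  "subseq (a # xs) w \<longleftrightarrow> (\<exists>i<length w. w ! i = a \<and> subseq xs (drop (Suc i) w))"
proof
  assume "subseq (a # xs) w"
  then obtain us vs where "w = us @ a # vs" "subseq xs vs"
    by (auto dest!: list_emb_ConsD)
  then show "\<exists>i<length w. w ! i = a \<and> subseq xs (drop (Suc i) w)"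
    by (intro exI[of _ "length us"]) auto
next
  assume "\<exists>i<length w. w ! i = a \<and> subseq xs (drop (Suc i) w)"
  then obtain i where i: "i < length w" "w ! i = a" "subseq xs (drop (Suc i) w)" by auto
  then have "subseq (a # xs) (take i w @ w ! i # drop (Suc i) w)"
    by (intro list_emb_append2) auto
  then show "subseq (a # xs) w" using i(1) by (metis id_take_nth_drop)
qed

text \<open>A subsequence of a concatenation splits into one subsequence of each factor; index
  quadruples do not show this, and the decomposition of words depends on it.\<close>

lemma non_crossing_iff_subseq:
  "non_crossing w \<longleftrightarrow> (\<forall>a b. a < b \<longrightarrow> \<not> subseq [a, b, a, b] w)"
proof -
  have "(\<exists>a b. a < b \<and> subseq [a, b, a, b] w) \<longleftrightarrow> (\<exists>i j k l. i < j \<and> j < k \<and> k < l \<and> l < length w \<and>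
     w ! i = w ! k \<and> w ! j = w ! l \<and> w ! i < w ! j)" (is "?L = ?R")
  proof
    assume ?L
    then obtain a b where "a < b" and "subseq [a, b, a, b] w" by blast
    then obtain i j k l where "i < length w" "w ! i = a"
      "j < length (drop (Suc i) w)" "drop (Suc i) w ! j = b"
      "k < length (drop (Suc j) (drop (Suc i) w))" "drop (Suc j) (drop (Suc i) w) ! k = a"
      "l < length (drop (Suc k) (drop (Suc j) (drop (Suc i) w)))"
      "drop (Suc k) (drop (Suc j) (drop (Suc i) w)) ! l = b"
      unfolding subseq_Cons_iff_nth by blast
    then have "i + j + k + l + 3 < length w" "w ! i = a" "w ! (i + j + 1) = b"
      "w ! (i + j + k + 2) = a" "w ! (i + j + k + l + 3) = b"
      by (simp_all add: less_diff_conv add_ac numeral_eq_Suc)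
    with \<open>a < b\<close> show ?R
      by (intro exI[of _ i] exI[of _ "i + j + 1"] exI[of _ "i + j + k + 2"] exI[of _ "i + j + k + l + 3"]) auto
  next
    assume ?R
    then obtain i j k l where *: "i < j" "j < k" "k < l" "l < length w"
     "w ! i = w ! k" "w ! j = w ! l" "w ! i < w ! j" by blast
    have "subseq [w ! i, w ! j, w ! k, w ! l] w"
      using * unfolding subseq_Cons_iff_nth[of "w ! i"] subseq_Cons_iff_nth[of "w ! j"] subseq_Cons_iff_nth[of "w ! k"] subseq_Cons_iff_nth[of "w ! l"]
      by (intro exI[of _ i] exI[of _ "j - Suc i"] exI[of _ "k - Suc j"] exI[of _ "l - Suc k"] conjI) auto
    then show ?L using * by auto
  qed
  then show ?thesis unfolding non_crossing_def by blast
qed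

section \<open>Canonical forms of set partitions as words\<close>

lemma rank_image:
  fixes T :: "nat set"
  assumes "finite T"
  shows "(\<lambda>t. card {s \<in> T. s \<le> t}) ` T = {1..card T}"
proof (rule card_subset_eq)
  have inj: "inj_on (\<lambda>t. card {s \<in> T. s \<le> t}) T"
  proof (rule linorder_inj_onI)
    fix x y assume "x < y" "x \<in> T" "y \<in> T"
    then have "y \<in> {s \<in> T. s \<le> y}" "y \<notin> {s \<in> T. s \<le> x}" "{s \<in> T. s \<le> x} \<subseteq> {s \<in> T. s \<le> y}" by auto
    then have "{s \<in> T. s \<le> x} \<subset> {s \<in> T. s \<le> y}" by blast
    then show "card {s \<in> T. s \<le> x} \<noteq> card {s \<in> T. s \<le> y}"
      using psubset_card_mono[of "{s \<in> T. s \<le> y}" "{s \<in> T. s \<le> x}"] assms by simp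
  qed auto
  show "card ((\<lambda>t. card {s \<in> T. s \<le> t}) ` T) = card {1..card T}"
    by (simp add: card_image[OF inj])
  show "(\<lambda>t. card {s \<in> T. s \<le> t}) ` T \<subseteq> {1..card T}"
  proof clarify
    fix t assume "t \<in> T"
    then have "{s \<in> T. s \<le> t} \<noteq> {}" by auto
    then have "card {s \<in> T. s \<le> t} > 0" using assms by (simp add: card_gt_0_iff del: Collect_empty_eq)
    moreover have "card {s \<in> T. s \<le> t} \<le> card T" using assms by (intro card_mono) auto
    ultimately show "card {s \<in> T. s \<le> t} \<in> {1..card T}" by simp
  qed
qed simp

lemma block_of_eq:
  assumes "partition_on A P" "B \<in> P" "i \<in> B"
  shows "block_of P i = B"
  unfolding block_of_def
proof (rule the_equality)
  fix B' assume "B' \<in> P \<and> i \<in> B'"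
  then show "B' = B" using partition_onD2[OF assms(1)] assms by (auto dest: disjointD)
qed (use assms in auto)

text \<open>The letters in the first \<open>k\<close> places are the ranks of the block minima met
  there, and those are precisely the minima not exceeding \<open>min k n\<close>. They form a lower
  set of all minima, so their ranks fill an initial interval.\<close>

lemma canonical_form_prefix:
  assumes P: "partition_on {1..n} P"
  shows "\<exists>M. set (take k (canonical_form n P)) = {1..M}"
proof -
  have sub: "B \<subseteq> {1..n}" "B \<noteq> {}" if "B \<in> P" for B
    using P that by (auto simp: partition_on_def)
  have fin: "finite B" if "B \<in> P" for B using sub[OF that] finite_subset by blast
  have Min: "Min B \<in> B" if "B \<in> P" for B using sub fin that by simp
  have finP: "finite P" using P finite_elements by blast
  have inj: "inj_on Min P"
    by (rule inj_on_inverseI[of _ "block_of P"]) (rule block_of_eq[OF P _ Min])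
  define T where "T = {s \<in> Min ` P. s \<le> min k n}"
  have card: "card {B \<in> P. Min B \<le> t} = card {s \<in> Min ` P. s \<le> t}" for t
  proof -
    have "{s \<in> Min ` P. s \<le> t} = Min ` {B \<in> P. Min B \<le> t}" by auto
    then show ?thesis using inj by (simp add: card_image inj_on_subset)
  qed
  have T: "(\<lambda>i. Min (block_of P i)) ` {1..min k n} = T"
  proof (intro equalityI subsetI)
    fix s assume "s \<in> (\<lambda>i. Min (block_of P i)) ` {1..min k n}"
    then obtain i where i: "i \<in> {1..min k n}" "s = Min (block_of P i)" by auto
    then have "i \<in> \<Union> P" using partition_onD1[OF P] by auto
    then obtain B where B: "B \<in> P" "i \<in> B" by blast
    have "block_of P i = B" by (rule block_of_eq[OF P B])
    then show "s \<in> T" using B i Min_le[OF fin[OF B(1)] B(2)] by (force simp: T_def)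
  next
    fix s assume "s \<in> T"
    then obtain B where B: "B \<in> P" "s = Min B" "s \<le> min k n" by (auto simp: T_def)
    \<comment> \<open>A minimum is itself a position of its block, so each small minimum is attained
      at the position \<open>s\<close>.\<close>
    have "block_of P s = B" unfolding B(2) by (rule block_of_eq[OF P B(1) Min[OF B(1)]])
    moreover have "s \<in> {1..min k n}"
      using Min[OF B(1)] sub[OF B(1)] B by auto
    ultimately show "s \<in> (\<lambda>i. Min (block_of P i)) ` {1..min k n}" using B by force
  qed
  have "take k [1..<n + 1] = [1..<min k n + 1]"
    by (cases "k \<le> n") (auto simp: take_upt min_def simp del: upt_Suc)
  then have "set (take k (canonical_form n P)) = (\<lambda>i. card {B \<in> P. Min B \<le> Min (block_of P i)}) ` {1..min k n}"
    unfolding canonical_form_def take_map by (simp add: atLeastLessThanSuc_atLeastAtMost del: upt_Suc)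
  also have "\<dots> = (\<lambda>t. card {s \<in> Min ` P. s \<le> t}) ` T"
    unfolding card T[symmetric] by (simp add: image_image)
  \<comment> \<open>\<open>T\<close> is closed downwards among the minima, so ranks in
    \<open>T\<close> agree with ranks among all minima.\<close>
  also have "\<dots> = (\<lambda>t. card {s \<in> T. s \<le> t}) ` T"
    by (intro image_cong refl arg_cong[of _ _ card]) (auto simp: T_def)
  also have "\<dots> = {1..card T}" by (rule rank_image) (use finP in \<open>auto simp: T_def\<close>)
  finally show ?thesis by blast
qed

text \<open>The blocks are the sets of places carrying a common letter. By the prefix condition a
  smaller letter makes its first appearance before a larger one, so numbering the blocks by their
  minima returns the letters.\<close>

lemma canonical_form_surj:
  assumes w: "\<And>k. \<exists>M. set (take k w) = {1..M}"
  defines "n \<equiv> length w"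
  shows "\<exists>P. partition_on {1..n} P \<and> canonical_form n P = w"
proof -
  define Bc where "Bc c = {i \<in> {1..n}. w ! (i - 1) = c}" for c
  define P where "P = Bc ` set w"
  have ne: "Bc c \<noteq> {}" if c: "c \<in> set w" for c
  proof -
    obtain i where "i < n" "w ! i = c" using c by (auto simp: in_set_conv_nth n_def)
    then have "Suc i \<in> Bc c" by (auto simp: Bc_def)
    then show ?thesis by blast
  qed
  have fin: "finite (Bc c)" for c by (simp add: Bc_def)
  have part: "partition_on {1..n} P"
  proof (rule partition_onI)
    show "\<Union> P = {1..n}"
    proof (intro equalityI subsetI)
      fix i assume "i \<in> {1..n}"
      then have "i \<in> Bc (w ! (i - 1))" "w ! (i - 1) \<in> set w" by (auto simp: Bc_def n_def)
      then show "i \<in> \<Union> P" by (auto simp: P_def)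
    qed (auto simp: P_def Bc_def)
    show "disjnt p p'" if "p \<in> P" "p' \<in> P" "p \<noteq> p'" for p p'
      using that by (auto simp: P_def Bc_def disjnt_def)
  qed (use ne in \<open>auto simp: P_def\<close>)
  have MinB: "Min (Bc c) \<in> Bc c" if "c \<in> set w" for c using ne fin that by simp
  have Min_less: "Min (Bc c) < Min (Bc d)" if "c \<in> set w" "d \<in> set w" "c < d" for c d
  proof -
    let ?k = "Min (Bc d)"
    have k: "?k \<ge> 1" "?k \<le> n" "w ! (?k - 1) = d" using MinB[OF that(2)] by (auto simp: Bc_def)
    \<comment> \<open>The prefix ending with the first \<open>d\<close> contains all letters from 1
      to \<open>d\<close>, in particular \<open>c\<close>, which thus occurs earlier.\<close>
    have "\<exists>i<?k. i < n \<and> w ! i = d" by (rule exI[of _ "?k - 1"]) (use k in auto)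
    then have "d \<in> set (take ?k w)" by (force simp: set_conv_nth n_def)
    moreover obtain M where "set (take ?k w) = {1..M}" using w by blast
    moreover have "c \<ge> 1" using w[of n] that(1) by (auto simp: n_def)
    ultimately have "c \<in> set (take ?k w)" using that by auto
    then obtain i where i: "i < ?k" "i < n" "w ! i = c" by (auto simp: in_set_conv_nth n_def)
    then have "Suc i \<in> Bc c" by (auto simp: Bc_def)
    then have "Min (Bc c) \<le> Suc i" using fin by simp
    then have "Min (Bc c) \<le> ?k" using i by simp
    moreover have "Min (Bc c) \<noteq> ?k" using MinB[OF that(1)] k(3) that(3) by (auto simp: Bc_def)
    ultimately show ?thesis by simp
  qed
  have le: "Min (Bc c) \<le> Min (Bc d) \<longleftrightarrow> c \<le> d" if "c \<in> set w" "d \<in> set w" for c d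
  proof (cases c d rule: linorder_cases)
    case less
    show ?thesis using Min_less[OF that less] less by simp
  next
    case greater
    show ?thesis using Min_less[OF that(2,1) greater] greater by simp
  qed simp
  have injB: "inj_on Bc (set w)" by (rule inj_onI) (metis le order_antisym order_refl)
  obtain M where M: "set w = {1..M}" using w[of n] by (auto simp: n_def)
  have "canonical_form n P = w"
  proof (rule nth_equalityI)
    show "length (canonical_form n P) = length w" by (simp add: canonical_form_def n_def del: upt_Suc)
    fix i assume "i < length (canonical_form n P)"
    then have i: "i < n" by (simp add: canonical_form_def del: upt_Suc)
    then have wi: "w ! i \<in> set w" by (simp add: n_def)
    have "block_of P (Suc i) = Bc (w ! i)"
      by (rule block_of_eq[OF part]) (use i in \<open>auto simp: P_def Bc_def n_def\<close>)
    then have "canonical_form n P ! i = card {B \<in> P. Min B \<le> Min (Bc (w ! i))}"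
      using i by (simp add: canonical_form_def del: upt_Suc)
    also have "{B \<in> P. Min B \<le> Min (Bc (w ! i))} = Bc ` {c \<in> set w. c \<le> w ! i}"
      using le wi by (auto simp: P_def)
    also have "card \<dots> = card {c \<in> set w. c \<le> w ! i}"
      using injB by (intro card_image) (auto intro: inj_on_subset)
    also have "{c \<in> set w. c \<le> w ! i} = {1..w ! i}" using wi M by auto
    finally show "canonical_form n P ! i = w ! i" by simp
  qed
  then show ?thesis using part by blast
qed

lemma NC_eq: "NC n = {w \<in> nc_words. length w = n}"
proof (intro equalityI subsetI)
  fix w assume "w \<in> NC n"
  then show "w \<in> {w \<in> nc_words. length w = n}"
    using canonical_form_prefix by (auto simp: NC_def nc_words_def canonical_form_def)
next
  fix w assume "w \<in> {w \<in> nc_words. length w = n}"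
  then show "w \<in> NC n"
    using canonical_form_surj[of w] by (auto simp: NC_def nc_words_def)
qed

lemma finite_NC [simp]: "finite (NC n)"
proof (rule finite_subset)
  show "NC n \<subseteq> {w. set w \<subseteq> {0..n} \<and> length w = n}"
  proof (intro subsetI CollectI conjI)
    fix w c assume w: "w \<in> NC n" and c: "c \<in> set w"
    then have "length w = n" "\<exists>M. set (take n w) = {1..M}"
      unfolding NC_eq nc_words_def by blast+
    then obtain M where "set (take n w) = {1..M}" "length w = n" by blast
    moreover have "card (set w) \<le> length w" by (rule card_length)
    ultimately show "c \<in> {0..n}" using c by auto
  qed (auto simp: NC_eq)
qed (rule finite_lists_length_eq, simp)

lemma nc_words_Nil [simp]: "[] \<in> nc_words"
  by (auto simp: nc_words_def non_crossing_def intro: exI[of _ 0])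

lemma nc_words_prefix:
  assumes "w \<in> nc_words"
  obtains M where "set (take k w) = {1..M}"
  using assms unfolding nc_words_def by blast

lemma nc_words_set: 
  assumes "w \<in> nc_words"
  shows "set w = {1..card (set w)}"
proof -
  obtain M where "set w = {1..M}" using nc_words_prefix[OF assms, of "length w"] by auto
  then show ?thesis by simp
qed

lemma nc_words_pos: "w \<in> nc_words \<Longrightarrow> c \<in> set w \<Longrightarrow> 0 < c"
  using nc_words_set[of w] by (metis atLeastAtMost_iff less_le_trans zero_less_one)

lemma nc_words_hd:
  assumes "w \<in> nc_words" "w \<noteq> []"
  shows "w ! 0 = 1"
proof -
  obtain M where "set (take 1 w) = {1..M}" using nc_words_prefix[OF assms(1)] .
  moreover have "set (take 1 w) = {w ! 0}" using assms(2) by (cases w) auto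
  ultimately have *: "{w ! 0} = {1..M}" by simp
  then have "w ! 0 \<in> {1..M}" by blast
  then have "1 \<in> {1..M}" by simp
  then show ?thesis unfolding *[symmetric] by simp
qed

lemma non_crossing_map:
  assumes "strict_mono_on (set w) f"
  shows "non_crossing (map f w) \<longleftrightarrow> non_crossing w"
proof -
  have less: "f c < f d \<longleftrightarrow> c < d" if "c \<in> set w" "d \<in> set w" for c d
    using strict_mono_on_less[OF assms that] .
  have eq: "f c = f d \<longleftrightarrow> c = d" if "c \<in> set w" "d \<in> set w" for c d
    using strict_mono_on_eq[OF assms that] .
  have "(i < j \<and> j < k \<and> k < l \<and> l < length (map f w) \<and>
     map f w ! i = map f w ! k \<and> map f w ! j = map f w ! l \<and> map f w ! i < map f w ! j) \<longleftrightarrow>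
     (i < j \<and> j < k \<and> k < l \<and> l < length w \<and> w ! i = w ! k \<and> w ! j = w ! l \<and> w ! i < w ! j)"
    for i j k l
  proof (cases "i < j \<and> j < k \<and> k < l \<and> l < length w")
    case True
    then have "i < length w" "j < length w" "k < length w" "l < length w" by auto
    then show ?thesis using less eq by simp
  qed auto
  then show ?thesis unfolding non_crossing_def by (simp only:)
qed

lemma non_crossing_subseq: "non_crossing w \<Longrightarrow> subseq v w \<Longrightarrow> non_crossing v"
  unfolding non_crossing_iff_subseq by (meson subseq_order.trans)

section \<open>Decomposition of words at the second 1\<close>

definition lift :: "nat \<Rightarrow> nat \<Rightarrow> nat" where
  "lift k c = (if c \<le> 1 then c else c + k)"

definition glue :: "nat list \<Rightarrow> nat list \<Rightarrow> nat list" where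
  "glue \<alpha> \<beta> = 1 # map Suc \<alpha> @ map (lift (card (set \<alpha>))) \<beta>"

text \<open>Fixing 0 along with 1 makes the map strictly increasing on all numbers, so it preserves
  occurrences in arbitrary words.\<close>

lemma strict_mono_lift: "strict_mono (lift k)"
  by (auto simp: strict_mono_def lift_def)

lemma length_glue [simp]: "length (glue \<alpha> \<beta>) = Suc (length \<alpha> + length \<beta>)"
  by (simp add: glue_def)

lemma lift_image: "lift K ` {1..M} = {c. c = 1 \<and> M \<ge> 1 \<or> K + 2 \<le> c \<and> c \<le> K + M}"
proof (intro equalityI subsetI)
  fix c assume "c \<in> {c. c = 1 \<and> M \<ge> 1 \<or> K + 2 \<le> c \<and> c \<le> K + M}"
  then have "c = lift K (if c = 1 then 1 else c - K)" "(if c = 1 then 1 else c - K) \<in> {1..M}"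
    by (auto simp: lift_def)
  then show "c \<in> lift K ` {1..M}" by (rule image_eqI)
qed (auto simp: lift_def split: if_splits)

text \<open>The two sides of the cut have at most the letter 1 in common. A crossing
  \<open>c d c d\<close> can therefore be distributed over them in few ways, each of which is
  impossible or yields a crossing inside one side.\<close>

lemma glue_nc_words:
  assumes a: "\<alpha> \<in> nc_words" and b: "\<beta> \<in> nc_words"
  shows "glue \<alpha> \<beta> \<in> nc_words"
proof -
  define K where "K = card (set \<alpha>)"
  define s where "s = map Suc \<alpha>"
  define v where "v = map (lift K) \<beta>"
  have w: "glue \<alpha> \<beta> = (1 # s) @ v" by (simp add: glue_def s_def v_def K_def)
  have set_s: "set s = {2..K + 1}"
    using nc_words_set[OF a] unfolding K_def s_def set_map
    by (metis Suc_1 Suc_eq_plus1 image_Suc_atLeastAtMost)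
  have prefix: "\<exists>M. set (take k (glue \<alpha> \<beta>)) = {1..M}" for k
  proof (cases k)
    case 0
    then show ?thesis by (auto intro: exI[of _ 0])
  next
    case (Suc j)
    show ?thesis
    proof (cases "j \<le> length \<alpha>")
      case True
      obtain M where "set (take j \<alpha>) = {1..M}" using nc_words_prefix[OF a] .
      then have "set (take k (glue \<alpha> \<beta>)) = insert 1 (Suc ` {1..M})"
        using Suc True by (simp add: w s_def take_map)
      also have "\<dots> = {1..Suc M}" unfolding image_Suc_atLeastAtMost by auto
      finally show ?thesis by blast
    next
      case False
      obtain M where "set (take (j - length \<alpha>) \<beta>) = {1..M}" using nc_words_prefix[OF b] .
      then have "set (take k (glue \<alpha> \<beta>)) = insert 1 ({2..K + 1} \<union> lift K ` {1..M})"
        using Suc False set_s by (simp add: w v_def s_def take_map)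
      \<comment> \<open>\<open>M = 0\<close> if \<beta> is empty; the leading 1 still counts, hence
        \<open>max 1 M\<close>.\<close>
      also have "\<dots> = {1..K + max 1 M}" unfolding lift_image by auto
      finally show ?thesis by blast
    qed
  qed
  have nc_s: "non_crossing s"
    using a by (simp add: s_def nc_words_def non_crossing_map strict_mono_on_def)
  have nc_v: "non_crossing v"
    using b strict_mono_lift[of K] by (simp add: v_def nc_words_def non_crossing_map strict_mono_on_def strict_mono_def)
  have common: "c = 1" if "c \<in> set (1 # s)" "c \<in> set v" for c
    using that nc_words_set[OF b] unfolding v_def by (auto simp: set_s lift_def split: if_splits)
  have v: "v = 1 # tl v" if "v \<noteq> []"
    using that nc_words_hd[OF b] by (cases \<beta>) (auto simp: v_def lift_def)
  have "\<not> subseq [c, d, c, d] ((1 # s) @ v)" if "c < d" for c d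
  proof
    assume "subseq [c, d, c, d] ((1 # s) @ v)"
    then obtain p r where pr: "[c, d, c, d] = p @ r" "subseq p (1 # s)" "subseq r v"
      unfolding subseq_append_iff by blast
    have sets: "set p \<subseteq> set (1 # s)" "set r \<subseteq> set v"
      using pr(2,3) by (auto elim: list_emb_set)
    have "p = [] \<and> r = [c, d, c, d] \<or> p = [c] \<and> r = [d, c, d] \<or> p = [c, d] \<and> r = [c, d] \<or>
        p = [c, d, c] \<and> r = [d] \<or> p = [c, d, c, d] \<and> r = []"
      using pr(1) unfolding Cons_eq_append_conv by fastforce
    then consider "p = []" "r = [c, d, c, d]" | "p = [c]" "r = [d, c, d]" | "p = [c, d]" "r = [c, d]"
      | "p = [c, d, c]" "r = [d]" | "p = [c, d, c, d]" "r = []"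
      by blast
    then show False
    proof cases
      case 1
      then show False using nc_v pr that by (auto simp: non_crossing_iff_subseq)
    next
      case 2
      \<comment> \<open>Here \<open>c\<close> lies on both sides, so it is 1, and the 1 at the head
        of \<open>v\<close> can take the place of the one before the cut.\<close>
      then have c: "c = 1" using common sets by auto
      have "v \<noteq> []" using 2 pr by auto
      then obtain v' where v': "v = 1 # v'" using v by blast
      then have "subseq [c, d, c, d] v" using 2 pr(3) c that by simp
      then show False using nc_v that by (auto simp: non_crossing_iff_subseq)
    next
      case 3
      then have "d = 1" "c = 1" using common sets by auto
      then show False using that by simp
    next
      case 4
      \<comment> \<open>This would leave only 0 for \<open>c\<close>, which is no letter.\<close>
      then have "d = 1" using common sets by auto
      then show False using that sets 4 by (auto simp: set_s)
    next
      case 5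
      show False
      proof (cases "c = 1")
        case True
        then have "subseq [d, c, d] s" using 5 pr by simp
        then have "c \<in> set s" using list_emb_set[of "(=)" "[d, c, d]" s c] by auto
        then show False using True by (simp add: set_s)
      next
        case False
        then have "subseq [c, d, c, d] s" using 5(1) pr(2) by simp
        then show False using nc_s that by (auto simp: non_crossing_iff_subseq)
      qed
    qed
  qed
  then have "non_crossing (glue \<alpha> \<beta>)" unfolding w non_crossing_iff_subseq by blast
  then show ?thesis using prefix by (simp add: nc_words_def)
qed

text \<open>\<alpha> is recovered as the longest stretch free of 1 behind the first letter, since
  \<beta> is empty or starts with 1.\<close>

lemma glue_inj:
  assumes "\<alpha> \<in> nc_words" "\<beta> \<in> nc_words" "\<alpha>' \<in> nc_words" "\<beta>' \<in> nc_words"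
    and eq: "glue \<alpha> \<beta> = glue \<alpha>' \<beta>'"
  shows "\<alpha> = \<alpha>' \<and> \<beta> = \<beta>'"
proof -
  have *: "takeWhile (\<lambda>c. c \<noteq> 1) (tl (glue \<alpha> \<beta>)) = map Suc \<alpha>"
    if "\<alpha> \<in> nc_words" "\<beta> \<in> nc_words" for \<alpha> \<beta>
  proof -
    have "\<forall>c\<in>set (map Suc \<alpha>). c \<noteq> 1" using nc_words_pos[OF that(1)] by auto
    moreover have "takeWhile (\<lambda>c. c \<noteq> 1) (map (lift K) \<beta>) = []" for K
      using nc_words_hd[OF that(2)] by (cases \<beta>) (auto simp: lift_def)
    ultimately show ?thesis by (auto simp: glue_def takeWhile_append takeWhile_eq_all_conv)
  qed
  have "map Suc \<alpha> = map Suc \<alpha>'" using * assms by metis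
  then have "\<alpha> = \<alpha>'" by (simp add: inj_map_eq_map)
  moreover from this have "map (lift (card (set \<alpha>))) \<beta> = map (lift (card (set \<alpha>))) \<beta>'"
    using eq by (simp add: glue_def)
  then have "\<beta> = \<beta>'"
    using strict_mono_imp_inj_on[OF strict_mono_lift] by (simp add: inj_map_eq_map)
  ultimately show ?thesis by simp
qed

lemma glue_surj:
  assumes w: "w \<in> nc_words" and "w \<noteq> []"
  shows "\<exists>\<alpha>\<in>nc_words. \<exists>\<beta>\<in>nc_words. w = glue \<alpha> \<beta>"
proof -
  obtain t where t: "w = 1 # t" using nc_words_hd[OF assms] \<open>w \<noteq> []\<close> by (cases w) auto
  define s where "s = takeWhile (\<lambda>c. c \<noteq> 1) t"
  define v where "v = dropWhile (\<lambda>c. c \<noteq> 1) t"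
  have wsv: "w = 1 # s @ v" by (simp add: t s_def v_def)
  have nc: "non_crossing w" using w by (simp add: nc_words_def)
  have s1: "1 \<notin> set s" unfolding s_def by (auto dest: set_takeWhileD)
  have v1: "v = 1 # tl v" if "v \<noteq> []" using that hd_dropWhile[of "\<lambda>c. c \<noteq> 1" t] unfolding v_def
    by (cases v) (auto simp: v_def)
  have pos: "c \<ge> 1" if "c \<in> set w" for c using nc_words_set[OF w] that by auto
  define \<alpha> where "\<alpha> = map (\<lambda>c. c - 1) s"
  have s: "s = map Suc \<alpha>"
    using pos by (force simp: \<alpha>_def wsv intro!: map_idI[symmetric])
  have prefix_a: "\<exists>M. set (take k \<alpha>) = {1..M}" for k
  proof (cases "k \<le> length \<alpha>")
    case True
    obtain M where "set (take (Suc k) w) = {1..M}" using nc_words_prefix[OF w] .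
    then have M: "insert 1 (Suc ` set (take k \<alpha>)) = {1..M}"
      using True by (simp add: wsv s take_map)
    have "set (take k \<alpha>) = {1..M - 1}"
    proof (rule set_eqI)
      fix c
      have "c \<in> set (take k \<alpha>) \<longleftrightarrow> Suc c \<in> Suc ` set (take k \<alpha>)" by auto
      moreover have "0 \<notin> set \<alpha>" using s1 s by auto
      then have "0 \<notin> set (take k \<alpha>)" by (meson in_set_takeD)
      moreover have "Suc c \<in> insert 1 (Suc ` set (take k \<alpha>)) \<longleftrightarrow> Suc c \<le> M" unfolding M by simp
      ultimately show "c \<in> set (take k \<alpha>) \<longleftrightarrow> c \<in> {1..M - 1}" by (cases "c = 0") auto
    qed
    then show ?thesis by blast
  next
    case False
    obtain M where "set (take (Suc (length \<alpha>)) w) = {1..M}" using nc_words_prefix[OF w] .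
    then have M: "insert 1 (Suc ` set \<alpha>) = {1..M}"
      by (simp add: wsv s take_map)
    have "set \<alpha> = {1..M - 1}"
    proof (rule set_eqI)
      fix c
      have "c \<in> set \<alpha> \<longleftrightarrow> Suc c \<in> Suc ` set \<alpha>" by auto
      moreover have "0 \<notin> set \<alpha>" using s1 s by auto
      moreover have "Suc c \<in> insert 1 (Suc ` set \<alpha>) \<longleftrightarrow> Suc c \<le> M" unfolding M by simp
      ultimately show "c \<in> set \<alpha> \<longleftrightarrow> c \<in> {1..M - 1}" by (cases "c = 0") auto
    qed
    then show ?thesis using False by auto
  qed
  have nc_s: "non_crossing s" using nc by (rule non_crossing_subseq) (simp add: wsv subseq_rev_drop_many list_emb_Cons)
  then have "non_crossing \<alpha>" unfolding s by (subst (asm) non_crossing_map) (auto simp: strict_mono_on_def)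
  then have a: "\<alpha> \<in> nc_words" using prefix_a by (simp add: nc_words_def)
  define K where "K = card (set \<alpha>)"
  have set_s: "set (1 # s) = {1..K + 1}"
  proof -
    have "set (1 # s) = insert 1 (Suc ` {1..K})" using nc_words_set[OF a] by (simp add: s K_def)
    also have "\<dots> = {1..K + 1}" unfolding image_Suc_atLeastAtMost by auto
    finally show ?thesis .
  qed
  \<comment> \<open>A letter \<open>c > 1\<close> of \<open>s\<close> that returned in
    \<open>v\<close> would form the crossing \<open>1 c 1 c\<close>, because \<open>v\<close> starts
    with 1. So all letters of \<open>v\<close> except 1 are new.\<close>
  have v_letters: "c = 1 \<or> c > K + 1" if "c \<in> set v" for c
  proof (rule ccontr)
    assume c: "\<not> (c = 1 \<or> c > K + 1)"
    have "c \<ge> 1" using pos that by (simp add: wsv)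
    then have "c \<in> set (1 # s)" unfolding set_s using c by simp
    then have c': "1 < c" "c \<in> set s" using c \<open>c \<ge> 1\<close> by auto
    have "v \<noteq> []" using that by auto
    then obtain v' where v': "v = 1 # v'" using v1 by blast
    then have "c \<in> set v'" using that c by auto
    then have "subseq [1, c] v"
      by (simp add: v' subseq_singleton_left)
    moreover have "subseq [1, c] (1 # s)" using c'(2) by (simp add: subseq_singleton_left)
    ultimately have "subseq ([1, c] @ [1, c]) ((1 # s) @ v)" by (intro list_emb_append_mono)
    then have "subseq [1, c, 1, c] w" unfolding wsv by simp
    then show False using nc c'(1) unfolding non_crossing_iff_subseq by blast
  qed
  define \<beta> where "\<beta> = map (\<lambda>c. if c = 1 then 1 else c - K) v"
  have v: "v = map (lift K) \<beta>"
  proof -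
    have "lift K (if c = 1 then 1 else c - K) = c" if "c \<in> set v" for c
      using v_letters[OF that] by (auto simp: lift_def)
    then show ?thesis by (simp add: \<beta>_def map_idI)
  qed
  have prefix_b: "\<exists>M. set (take k \<beta>) = {1..M}" for k
  proof (cases "k = 0 \<or> v = []")
    case True
    then show ?thesis by (auto simp: \<beta>_def intro: exI[of _ 0])
  next
    case False
    obtain M where "set (take (Suc (length s) + k) w) = {1..M}" using nc_words_prefix[OF w] .
    then have M: "{1..K + 1} \<union> set (take k v) = {1..M}"
      unfolding set_s[symmetric] by (simp add: wsv)
    have "1 \<in> set (take k v)" using False v1 by (cases k) (auto, metis list.set_intros(1) take_Suc_Cons)
    have sub: "set (take k v) \<subseteq> set v" by (rule set_take_subset)
    have "set (take k \<beta>) = (\<lambda>c. if c = 1 then 1 else c - K) ` set (take k v)"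
      by (simp add: \<beta>_def take_map)
    \<comment> \<open>The letters of \<open>1 # s\<close> fill \<open>{1..K + 1}\<close>, so
      lowering the new letters of \<open>v\<close> by \<open>K\<close> closes the gap above
      1.\<close>
    also have "\<dots> = {1..M - K}"
    proof (intro equalityI subsetI)
      fix d assume "d \<in> (\<lambda>c. if c = 1 then 1 else c - K) ` set (take k v)"
      then obtain c where c: "c \<in> set (take k v)" "d = (if c = 1 then 1 else c - K)" by blast
      have "K + 1 \<in> {1..M}" unfolding M[symmetric] by auto
      moreover have "c \<in> {1..M}" unfolding M[symmetric] using c by blast
      moreover have "c = 1 \<or> c > K + 1" using c sub v_letters by blast
      ultimately show "d \<in> {1..M - K}" using c(2) by (auto split: if_splits)
    next
      fix d assume d: "d \<in> {1..M - K}"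
      show "d \<in> (\<lambda>c. if c = 1 then 1 else c - K) ` set (take k v)"
      proof (cases "d = 1")
        case True
        then show ?thesis using \<open>1 \<in> set (take k v)\<close> by force
      next
        case False
        then have "d + K \<in> {1..M}" "d + K \<notin> {1..K + 1}" using d by auto
        then have "d + K \<in> set (take k v)" using M by blast
        then show ?thesis using False d by (intro image_eqI[of _ _ "d + K"]) auto
      qed
    qed
    finally show ?thesis by blast
  qed
  have "non_crossing v" using nc by (rule non_crossing_subseq) (auto simp: wsv)
  then have "non_crossing \<beta>"
    unfolding v using strict_mono_lift[of K]
    by (subst (asm) non_crossing_map) (auto simp: strict_mono_on_def strict_mono_def)
  then have b: "\<beta> \<in> nc_words" using prefix_b by (simp add: nc_words_def)
  have "w = glue \<alpha> \<beta>" unfolding glue_def K_def[symmetric] v[symmetric] s[symmetric] by (rule wsv)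
  then show ?thesis using a b by blast
qed

section \<open>Occurrences of the pattern\<close>

text \<open>Order isomorphism is expressed by positions in the full word, so that a word can be
  compared directly with a concatenation containing it.\<close>

definition occurs_at :: "nat list \<Rightarrow> nat list \<Rightarrow> nat \<Rightarrow> bool" where
  "occurs_at t s i \<longleftrightarrow> i + length t \<le> length s \<and>
     (\<forall>j<length t. \<forall>k<length t. (s ! (i + j) < s ! (i + k) \<longleftrightarrow> t ! j < t ! k) \<and>
        (s ! (i + j) = s ! (i + k) \<longleftrightarrow> t ! j = t ! k))"

lemma occurrences_eq: "occurrences t s = card {i. occurs_at t s i}"
  unfolding occurrences_def occurs_at_def order_isomorphic_def
  by (rule arg_cong[of _ _ card]) auto

lemma finite_occurs_at [simp]: "finite {i. occurs_at t s i \<and> P i}" "finite {i. occurs_at t s i}"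
  by (rule finite_subset[of _ "{..length s}"]; auto simp: occurs_at_def)+

lemma occurs_at_map:
  assumes "strict_mono f"
  shows "occurs_at t (map f s) i \<longleftrightarrow> occurs_at t s i"
  using strict_mono_less[OF assms] strict_mono_eq[OF assms]
  by (auto simp: occurs_at_def)

lemma occurrences_map: "strict_mono f \<Longrightarrow> occurrences t (map f s) = occurrences t s"
  by (simp add: occurrences_eq occurs_at_map)

lemma occurs_at_append_right: "occurs_at t (X @ Z) (length X + i) \<longleftrightarrow> occurs_at t Z i"
  by (simp add: occurs_at_def nth_append add.assoc)

lemma occurs_at_append_left:
  "i + length t \<le> length X \<Longrightarrow> occurs_at t (X @ Z) i \<longleftrightarrow> occurs_at t X i"
  by (simp add: occurs_at_def nth_append)

text \<open>An occurrence that starts in \<open>X\<close> may still reach into \<open>Z\<close>; it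
  belongs to the first summand.\<close>

lemma occurrences_append:
  "occurrences t (X @ Z) = card {i. occurs_at t (X @ Z) i \<and> i < length X} + occurrences t Z"
proof -
  have "{i. occurs_at t (X @ Z) i} = {i. occurs_at t (X @ Z) i \<and> i < length X} \<union> 
      (+) (length X) ` {i. occurs_at t Z i}" (is "_ = ?A \<union> ?B")
  proof (intro equalityI subsetI)
    fix i assume i: "i \<in> {i. occurs_at t (X @ Z) i}"
    show "i \<in> ?A \<union> ?B"
    proof (cases "i < length X")
      case False
      then have "i = length X + (i - length X)" by simp
      then show ?thesis using i occurs_at_append_right[of t X Z "i - length X"] by auto
    qed (use i in auto)
  qed (auto simp: occurs_at_append_right)
  moreover have "?A \<inter> ?B = {}" by auto
  ultimately show ?thesis
    by (simp add: occurrences_eq card_Un_disjoint card_image)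
qed

text \<open>An occurrence straddling the border would contain the last letter of \<open>X\<close>
  and the first of \<open>Y\<close> as neighbours, that is, a descent, while \<open>t\<close> weakly
  increases.\<close>

lemma occurrences_append_descent:
  assumes "sorted t" "t \<noteq> []" "X \<noteq> []" "Y \<noteq> []" "hd Y < last X"
  shows "occurrences t (X @ Y) = occurrences t X + occurrences t Y"
proof -
  have "occurs_at t (X @ Y) i \<and> i < length X \<longleftrightarrow> occurs_at t X i" for i
  proof (cases "i + length t \<le> length X")
    case True
    then show ?thesis using assms(2) by (cases t) (auto simp: occurs_at_append_left)
  next
    case False
    have "\<not> (occurs_at t (X @ Y) i \<and> i < length X)"
    proof
      assume i: "occurs_at t (X @ Y) i \<and> i < length X"
      \<comment> \<open>The place within the pattern that falls on the last letter of
        \<open>X\<close>.\<close>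
      define j where "j = length X - 1 - i"
      have "(X @ Y) ! (i + j) = last X" "(X @ Y) ! (i + Suc j) = hd Y"
        using i assms by (auto simp: j_def nth_append last_conv_nth hd_conv_nth)
      moreover have "Suc j < length t" using i False unfolding j_def by linarith
      ultimately have "t ! Suc j < t ! j"
        using i assms(5) by (metis Suc_lessD occurs_at_def)
      then show False
        using sorted_nth_mono[OF assms(1), of j "Suc j"] \<open>Suc j < length t\<close> by simp
    qed
    then show ?thesis using False by (simp add: occurs_at_def)
  qed
  then show ?thesis unfolding occurrences_append[of t X Y] by (simp add: occurrences_eq)
qed

lemma length_pat [simp]: "length (pat a m) = m - 1 + a"
  by (simp add: pat_def)

lemma pat_nth: "j < m - 1 + a \<Longrightarrow> m \<ge> 1 \<Longrightarrow> pat a m ! j = min (Suc j) m"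
  by (auto simp: pat_def nth_append)

lemma sorted_pat: "sorted (pat a m)"
  by (auto simp: pat_def sorted_append)

text \<open>The pattern is reduced to a strict rise over its first \<open>m\<close> letters and a
  plateau of \<open>a\<close> letters, which suffices to locate occurrences.\<close>

lemma occurs_at_pat_imp:
  assumes "a \<ge> 2" "m \<ge> 1" "occurs_at (pat a m) s i"
  shows "\<And>j. j < m - 1 \<Longrightarrow> s ! (i + j) < s ! (i + Suc j)"
    and "\<And>j. j < a \<Longrightarrow> s ! (i + (m - 1) + j) = s ! (i + (m - 1))"
    and "i + (m - 1) + a \<le> length s"
proof -
  have *: "(s ! (i + j) < s ! (i + k) \<longleftrightarrow> min (Suc j) m < min (Suc k) m) \<and>
        (s ! (i + j) = s ! (i + k) \<longleftrightarrow> min (Suc j) m = min (Suc k) m)"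
    if "j < m - 1 + a" "k < m - 1 + a" for j k
    using assms that by (simp add: occurs_at_def pat_nth)
  show "s ! (i + j) < s ! (i + Suc j)" if "j < m - 1" for j
    using *[of j "Suc j"] that assms by auto
  show "s ! (i + (m - 1) + j) = s ! (i + (m - 1))" if "j < a" for j
    using *[of "m - 1 + j" "m - 1"] that assms by (auto simp: add.assoc)
  show "i + (m - 1) + a \<le> length s" using assms(3) by (simp add: occurs_at_def)
qed

lemma occurrences_pat_upt [simp]:
  assumes "a \<ge> 2" "m \<ge> 1"
  shows "occurrences (pat a m) [1..<n] = 0"
proof -
  have "\<not> occurs_at (pat a m) [1..<n] i" for i
  proof
    assume o: "occurs_at (pat a m) [1..<n] i"
    show False using occurs_at_pat_imp(2)[OF assms o, of 1] occurs_at_pat_imp(3)[OF assms o] assms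
      by (simp add: nth_append)
  qed
  then show ?thesis by (simp add: occurrences_eq)
qed

text \<open>The plateau of an occurrence that starts within the initial rise must begin exactly at
  the last letter of the rise. So there is at most one, and it exists when the rise is long enough
  and \<beta> continues the plateau by \<open>a - 1\<close> ones.\<close>

lemma occurrences_run:
  assumes "a \<ge> 2" "m \<ge> 2" and \<beta>: "\<beta> \<noteq> []" "\<beta> ! 0 = 1"
  shows "occurrences (pat a m) ([1..<l + 2] @ map (\<lambda>c. c + l) \<beta>) =
    (if m - 1 \<le> l \<and> take (a - 1) \<beta> = replicate (a - 1) 1 then 1 else 0) + occurrences (pat a m) \<beta>"
proof -
  define s where "s = [1..<l + 2] @ map (\<lambda>c. c + l) \<beta>"
  have s1: "s ! j = Suc j" if "j \<le> l" for j
    using that by (simp add: s_def nth_append del: upt_Suc)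
  have s2: "s ! (Suc l + j) = \<beta> ! j + l" if "j < length \<beta>" for j
    using that by (simp add: s_def nth_append del: upt_Suc)
  have s3: "s ! Suc l = Suc l" using s2[of 0] \<beta> by simp
  have len: "length s = Suc l + length \<beta>" by (simp add: s_def)
  let ?c = "m - 1 \<le> l \<and> take (a - 1) \<beta> = replicate (a - 1) 1"
  have 1: "?c \<and> i + (m - 1) = l" if o: "occurs_at (pat a m) s i" and i: "i \<le> l" for i
  proof -
    have m1: "m \<ge> 1" using assms by simp
    note o = occurs_at_pat_imp[OF assms(1) m1 o]
    \<comment> \<open>If the plateau began earlier, its first two letters would differ; if later,
      the increasing part would run over the two equal letters \<open>l + 1\<close>.\<close>
    have il: "i + (m - 1) = l"
    proof (cases "i + (m - 1)" l rule: linorder_cases)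
      case less
      then have "i + (m - 1) + 1 \<le> l" by simp
      then show ?thesis using o(2)[of 1] s1[of "i + (m - 1)"] s1[of "i + (m - 1) + 1"] assms(1) by linarith
    next
      case greater
      then have "l - i < m - 1" using i by linarith
      from o(1)[OF this] show ?thesis using s1[of l] s3 i by simp
    qed simp
    have "\<beta> ! j = 1" if "j < a - 1" for j
      using o(2)[of "Suc j"] o(3) that s1[of l] s2[of j] len unfolding il by simp
    moreover have "a - 1 \<le> length \<beta>" using o(3) len il by simp
    ultimately have "take (a - 1) \<beta> = replicate (a - 1) 1" by (intro nth_equalityI) auto
    then show ?thesis using il by simp
  qed
  have 2: "occurs_at (pat a m) s (l - (m - 1))" if c: ?c
  proof -
    have "length (take (a - 1) \<beta>) = a - 1" using c by simp
    then have la: "a - 1 \<le> length \<beta>" by simp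
    have b: "\<beta> ! j = 1" if "j < a - 1" for j using c that by (metis nth_replicate nth_take)
    have "s ! (l - (m - 1) + j) = l - (m - 1) + pat a m ! j" if j: "j < m - 1 + a" for j
    proof (cases "j < m")
      case True
      then have "l - (m - 1) + j \<le> l" using c by linarith
      then show ?thesis using s1 True j assms(2) pat_nth[OF j] by simp
    next
      case False
      then have "l - (m - 1) + j = Suc l + (j - m)" using c assms(2) by linarith
      moreover have "j - m < a - 1" using j False assms(2) by linarith
      then have "\<beta> ! (j - m) = 1" by (rule b)
      ultimately show ?thesis using c s2[of "j - m"] assms(2) j False la by (simp add: pat_nth)
    qed
    moreover have "l - (m - 1) + (m - 1 + a) \<le> length s" using c assms la len by linarith
    ultimately show ?thesis by (simp add: occurs_at_def)
  qed
  have "{i. occurs_at (pat a m) s i \<and> i < length [1..<l + 2]} = (if ?c then {l - (m - 1)} else {})"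
  proof (cases ?c)
    case True
    have "i = l - (m - 1)" if "occurs_at (pat a m) s i" "i \<le> l" for i
      using 1[OF that] by linarith
    moreover have "l - (m - 1) < length [1..<l + 2]" unfolding length_upt by linarith
    moreover have "i \<le> l" if "i < length [1..<l + 2]" for i
      using that unfolding length_upt by linarith
    ultimately have "{i. occurs_at (pat a m) s i \<and> i < length [1..<l + 2]} = {l - (m - 1)}"
      using 2[OF True] by blast
    then show ?thesis unfolding if_P[OF True] .
  next
    case False
    have "{i. occurs_at (pat a m) s i \<and> i < length [1..<l + 2]} = {}"
    proof (rule equals0I)
      fix i assume "i \<in> {i. occurs_at (pat a m) s i \<and> i < length [1..<l + 2]}"
      then have "occurs_at (pat a m) s i" "i < length [1..<l + 2]" by blast+
      then have "occurs_at (pat a m) s i" "i \<le> l" unfolding length_upt by linarith+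
      from 1[OF this] False show False by blast
    qed
    then show ?thesis unfolding if_not_P[OF False] .
  qed
  then have "card {i. occurs_at (pat a m) s i \<and> i < length [1..<l + 2]} = (if ?c then 1 else 0)"
    by simp
  moreover have "occurrences (pat a m) (map (\<lambda>c. c + l) \<beta>) = occurrences (pat a m) \<beta>"
    by (intro occurrences_map) (simp add: strict_mono_def)
  ultimately show ?thesis
    unfolding occurrences_append s_def by simp
qed

text \<open>Without a second 1, the first letter of the glued word merely prolongs the initial
  rise.\<close>

lemma occurrences_shift_glue_Nil:
  "occurrences_shift t l (glue \<alpha> []) = occurrences_shift t (Suc l) \<alpha>"
proof -
  have "[1..<l+1] @ map (\<lambda>c. c + l) (glue \<alpha> []) = [1..<Suc l+1] @ map (\<lambda>c. c + Suc l) \<alpha>"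
    by (simp add: glue_def)
  then show ?thesis by (simp add: occurrences_shift_def)
qed

lemma occurrences_shift_0 [simp]: "occurrences_shift t 0 w = occurrences t w"
  by (simp add: occurrences_shift_def)

text \<open>The shifted \<alpha> ends in a letter above \<open>l + 1\<close>, while the second part
  begins with \<open>l + 1\<close>. This descent separates the occurrences.\<close>

lemma occurrences_shift_glue:
  assumes "a \<ge> 2" "m \<ge> 2" and \<alpha>: "\<alpha> \<in> nc_words" "\<alpha> \<noteq> []" and \<beta>: "\<beta> \<in> nc_words" "\<beta> \<noteq> []"
  shows "occurrences_shift (pat a m) l (glue \<alpha> \<beta>) =
    occurrences_shift (pat a m) (Suc l) \<alpha> + occurrences (pat a m) \<beta>"
proof -
  let ?X = "[1..<Suc l+1] @ map (\<lambda>c. c + Suc l) \<alpha>"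
  let ?f = "\<lambda>c. lift (card (set \<alpha>)) c + l"
  have "[1..<l+1] @ map (\<lambda>c. c + l) (glue \<alpha> \<beta>) = ?X @ map ?f \<beta>"
    by (simp add: glue_def)
  moreover have "occurrences (pat a m) (?X @ map ?f \<beta>) =
      occurrences (pat a m) ?X + occurrences (pat a m) (map ?f \<beta>)"
  proof (rule occurrences_append_descent)
    have "hd (map ?f \<beta>) = Suc l"
      using nc_words_hd[OF \<beta>] \<beta>(2) by (simp add: hd_map hd_conv_nth lift_def)
    moreover have "last ?X > Suc l"
      using nc_words_pos[OF \<alpha>(1), of "last \<alpha>"] \<alpha>(2) by (simp add: last_map)
    ultimately show "hd (map ?f \<beta>) < last ?X" by simp
    show "pat a m \<noteq> []" using assms(1) by (simp add: pat_def)
  qed (use \<alpha> \<beta> sorted_pat in auto)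
  moreover have "occurrences (pat a m) (map ?f \<beta>) = occurrences (pat a m) \<beta>"
    using strict_mono_lift by (intro occurrences_map) (simp add: strict_mono_def)
  ultimately show ?thesis by (simp add: occurrences_shift_def)
qed

lemma glue_Nil: "glue [] \<beta> = 1 # \<beta>"
  by (simp add: glue_def map_idI lift_def)

lemma occurrences_shift_glue_run:
  assumes "a \<ge> 2" "m \<ge> 2" and \<beta>: "\<beta> \<in> nc_words" "\<beta> \<noteq> []"
  shows "occurrences_shift (pat a m) l (glue [] \<beta>) =
    (if m - 1 \<le> l \<and> take (a - 1) \<beta> = replicate (a - 1) 1 then 1 else 0) + occurrences (pat a m) \<beta>"
proof -
  have "[1..<l+1] @ map (\<lambda>c. c + l) (glue [] \<beta>) = [1..<l + 2] @ map (\<lambda>c. c + l) \<beta>"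
    by (simp add: glue_Nil)
  then show ?thesis
    using occurrences_run[OF assms(1,2) \<beta>(2) nc_words_hd[OF \<beta>], of l] by (simp add: occurrences_shift_def)
qed

text \<open>Both parts of a glued word are shorter than it, so gluing acts as the constructor of a
  structural induction.\<close>

lemma nc_words_induct [consumes 1, case_names Nil glue]:
  assumes "w \<in> nc_words" "P []"
    and "\<And>\<alpha> \<beta>. \<alpha> \<in> nc_words \<Longrightarrow> \<beta> \<in> nc_words \<Longrightarrow> P \<alpha> \<Longrightarrow> P \<beta> \<Longrightarrow> P (glue \<alpha> \<beta>)"
  shows "P w"
  using assms(1)
proof (induction "length w" arbitrary: w rule: less_induct)
  case less
  show ?case
  proof (cases "w = []")
    case False
    then obtain \<alpha> \<beta> where "\<alpha> \<in> nc_words" "\<beta> \<in> nc_words" "w = glue \<alpha> \<beta>"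
      using glue_surj less.prems by blast
    then show ?thesis using less.hyps assms(3) by simp
  qed (use assms(2) in simp)
qed

section \<open>The smallest repeated letter\<close>

lemma rep_glue:
  assumes \<alpha>: "\<alpha> \<in> nc_words" and \<beta>: "\<beta> \<in> nc_words" "\<beta> \<noteq> []"
  shows "rep (glue \<alpha> \<beta>) = 1"
proof -
  let ?w = "glue \<alpha> \<beta>"
  have "lift (card (set \<alpha>)) (hd \<beta>) = 1"
    using nc_words_hd[OF \<beta>] \<beta>(2) by (simp add: hd_conv_nth lift_def)
  then have c: "count_list ?w 1 \<ge> 2"
    using \<beta>(2) by (cases \<beta>) (simp_all add: glue_def)
  have "0 \<notin> set ?w" using nc_words_pos[OF glue_nc_words[OF \<alpha> \<beta>(1)]] by blast
  then have c0: "count_list ?w 0 = 0" by (rule count_notin)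
  have "?w \<noteq> [1..<length ?w + 1]"
  proof
    assume "?w = [1..<length ?w + 1]"
    then have "distinct ?w" by (metis distinct_upt)
    then have "count_list ?w 1 = card (set (filter ((=) 1) ?w))"
      unfolding count_list_eq_length_filter by (metis distinct_card distinct_filter)
    also have "\<dots> \<le> card {1::nat}" by (intro card_mono) auto
    finally show False using c by simp
  qed
  moreover have "(LEAST c. 2 \<le> count_list ?w c) = 1"
    by (rule Least_equality) (use c c0 in \<open>auto intro!: Suc_leI gr0I\<close>)
  ultimately show ?thesis by (simp add: rep_def)
qed

text \<open>Guarantees that the \<open>LEAST\<close> in \<open>rep\<close> has a witness whenever it
  is evaluated.\<close>

lemma nc_words_repeated:
  "w \<in> nc_words \<Longrightarrow> w = [1..<length w + 1] \<or> (\<exists>c. 2 \<le> count_list w c)"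
proof (induction rule: nc_words_induct)
  case (glue \<alpha> \<beta>)
  show ?case
  proof (cases "\<beta> = []")
    case False
    have "lift (card (set \<alpha>)) (hd \<beta>) = 1"
      using nc_words_hd[OF glue(2) False] False by (simp add: hd_conv_nth lift_def)
    then have "count_list (glue \<alpha> \<beta>) 1 \<ge> 2"
      using False by (cases \<beta>) (simp_all add: glue_def)
    then show ?thesis by blast
  next
    case True
    from glue(3) show ?thesis
    proof (elim disjE exE)
      assume "\<alpha> = [1..<length \<alpha> + 1]"
      then have "glue \<alpha> \<beta> = 1 # map Suc [1..<length \<alpha> + 1]" using True by (simp add: glue_def)
      also have "\<dots> = [1..<length (glue \<alpha> \<beta>) + 1]"
        using True by (simp add: map_Suc_upt upt_conv_Cons del: upt_Suc)
      finally show ?thesis by blast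
    next
      fix c assume "2 \<le> count_list \<alpha> c"
      then have "2 \<le> count_list (glue \<alpha> \<beta>) (Suc c)"
        using True by (auto simp: glue_def count_list_map_conv)
      then show ?thesis by blast
    qed
  qed
qed simp

lemma rep_eq_0_iff:
  assumes "w \<in> nc_words"
  shows "rep w = 0 \<longleftrightarrow> w = [1..<length w + 1]"
proof
  assume r: "rep w = 0"
  show "w = [1..<length w + 1]"
  proof (rule ccontr)
    assume "w \<noteq> [1..<length w + 1]"
    then have "\<exists>c. 2 \<le> count_list w c" "rep w = (LEAST c. 2 \<le> count_list w c)"
      using nc_words_repeated[OF assms] by (auto simp: rep_def)
    then have "2 \<le> count_list w 0" using r by (metis LeastI_ex)
    moreover have "0 \<notin> set w" using nc_words_pos[OF assms] by blast
    ultimately show False by simp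
  qed
qed (simp add: rep_def)

lemma rep_glue_Nil:
  assumes \<alpha>: "\<alpha> \<in> nc_words"
  shows "rep (glue \<alpha> []) = (if rep \<alpha> = 0 then 0 else Suc (rep \<alpha>))"
proof (cases "\<alpha> = [1..<length \<alpha> + 1]")
  case True
  then have "glue \<alpha> [] = 1 # map Suc [1..<length \<alpha> + 1]" by (simp add: glue_def)
  also have "\<dots> = [1..<length (glue \<alpha> []) + 1]"
    by (simp add: map_Suc_upt upt_conv_Cons del: upt_Suc)
  finally show ?thesis using True rep_def by metis
next
  case False
  have pos: "0 \<notin> set \<alpha>" using nc_words_pos[OF \<alpha>] by blast
  \<comment> \<open>The leading 1 raises only the count of \<open>Suc 0\<close>, a letter that
    \<open>map Suc \<alpha>\<close> does not contain; so no new repetition arises.\<close>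
  have count: "count_list (glue \<alpha> []) (Suc c) = count_list \<alpha> c + (if c = 0 then 1 else 0)" for c
    by (simp add: glue_def count_list_map_conv)
  have count0: "count_list (glue \<alpha> []) 0 = 0"
    by (rule count_notin) (auto simp: glue_def)
  have ne: "glue \<alpha> [] \<noteq> [1..<length (glue \<alpha> []) + 1]"
  proof
    assume "glue \<alpha> [] = [1..<length (glue \<alpha> []) + 1]"
    then have "1 # map Suc \<alpha> = 1 # map Suc [1..<length \<alpha> + 1]"
      by (simp add: glue_def map_Suc_upt upt_conv_Cons del: upt_Suc)
    then show False using False by (simp add: inj_map_eq_map del: upt_Suc)
  qed
  obtain c where c: "2 \<le> count_list \<alpha> c" using nc_words_repeated[OF \<alpha>] False by blast
  have iff: "2 \<le> count_list (glue \<alpha> []) (Suc c) \<longleftrightarrow> 2 \<le> count_list \<alpha> c" for c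
    using pos by (auto simp: count)
  have "(LEAST c. 2 \<le> count_list (glue \<alpha> []) c) = Suc (LEAST c. 2 \<le> count_list (glue \<alpha> []) (Suc c))"
    by (rule Least_Suc[of _ "Suc c"]) (use c iff count0 in auto)
  then have "rep (glue \<alpha> []) = Suc (LEAST c. 2 \<le> count_list \<alpha> c)"
    using ne by (simp add: rep_def iff)
  moreover have "rep \<alpha> = (LEAST c. 2 \<le> count_list \<alpha> c)" using False by (simp add: rep_def)
  moreover have "rep \<alpha> \<noteq> 0" using False rep_eq_0_iff[OF \<alpha>] by simp
  ultimately show ?thesis by simp
qed

lemma rep_le_length: "w \<in> nc_words \<Longrightarrow> rep w \<le> length w"
proof (induction rule: nc_words_induct)
  case (glue \<alpha> \<beta>)
  then show ?case by (cases "\<beta> = []") (auto simp: rep_glue rep_glue_Nil)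
qed (simp add: rep_def)

section \<open>Catalan numbers and the series L and M\<close>

text \<open>The division in \<open>catalan\<close> is exact, since \<open>n + 1\<close> times the
  difference of \<open>2 * n choose n\<close> and \<open>2 * n choose (n + 1)\<close> is the former
  coefficient.\<close>

lemma catalan_real: "real (catalan n) * real (n + 1) = real (2 * n choose n)"
proof -
  have "(n + 1) * (2 * n choose (n + 1)) = n * (2 * n choose n)"
    using binomial_absorb_comp[of "2 * n" n] binomial_absorption[of n "2 * n"]
    unfolding Suc_eq_plus1 by (metis add_diff_cancel_right' mult_2)
  then have "real (n + 1) * real (2 * n choose (n + 1)) = real n * real (2 * n choose n)"
    unfolding of_nat_mult[symmetric] by (simp only:)
  then have "real_of_int (int (2 * n choose n)) = real_of_int (int (n + 1) * (int (2 * n choose n) - int (2 * n choose (n + 1))))"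
    by (simp add: algebra_simps)
  then have "int (n + 1) dvd int (2 * n choose n)"
    unfolding of_int_eq_iff by (metis dvd_triv_left)
  then have "n + 1 dvd (2 * n choose n)" by (simp only: int_dvd_int_iff)
  then have "catalan n * (n + 1) = (2 * n choose n)" unfolding catalan_def by (rule dvd_div_mult_self)
  then show ?thesis unfolding of_nat_mult[symmetric] by (simp only:)
qed

lemma catalan_rec: "real (n + 2) * real (catalan (Suc n)) = real (4 * n + 2) * real (catalan n)"
proof -
  have f: "real (2 * n choose n) = fact (2 * n) / (fact n * fact n)" for n
    using binomial_fact[of n "2 * n", where 'a = real] by simp
  have fs: "fact (2 * Suc n) = real (2 * n + 2) * real (2 * n + 1) * fact (2 * n)"
    "fact (Suc n) = real (n + 1) * fact n" by (simp_all add: algebra_simps)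
  have cancel: "x * G / ((N * F) * (N * F)) * N * N = x * (G / (F * F))"
    if "N \<noteq> 0" "F \<noteq> 0" for x G N F :: real
    using that by (simp add: field_simps)
  have "real (2 * Suc n choose Suc n) * real (n + 1) * real (n + 1) = real (2 * n + 2) * real (2 * n + 1) * real (2 * n choose n)"
    unfolding f fs by (rule cancel) simp_all
  then have "real (n + 1) * real (n + 1) * (real (n + 2) * real (catalan (Suc n))) =
     real (n + 1) * real (n + 1) * (real (4 * n + 2) * real (catalan n))"
    unfolding catalan_real[symmetric] by (simp add: algebra_simps)
  moreover have "real (n + 1) * real (n + 1) \<noteq> 0" by simp
  ultimately show ?thesis by (metis mult_left_cancel)
qed

lemma catalan_0 [simp]: "catalan 0 = 1" and catalan_1 [simp]: "catalan (Suc 0) = 1"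
  by (simp_all add: catalan_def numeral_2_eq_2)

text \<open>The right-hand side is \<open>-1/2\<close> times the coefficient of \<open>x ^ (n + 1)\<close> in \<open>sqrt (1 - 4 * x)\<close>, so that the
  Catalan recurrence becomes Vandermonde's identity for \<open>1/2 + 1/2 = 1\<close>.\<close>

lemma catalan_gbinomial: "real (catalan n) = (-1) ^ n * 2 ^ (2 * n + 1) * ((1/2) gchoose (n + 1))"
proof (induction n)
  case (Suc n)
  let ?g = "\<lambda>k. (1 / 2 :: real) gchoose k"
  have "real (n + 2) * ?g (n + 2) = (1 / 2 - real (n + 1)) * ?g (n + 1)"
    using gbinomial_absorption[of "n + 1" "1 / 2 :: real"] gbinomial_absorb_comp[of "1 / 2 :: real" "n + 1"]
    by simp
  then have "real (n + 2) * ((-1) ^ Suc n * 2 ^ (2 * Suc n + 1) * ?g (Suc n + 1)) =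
      (-1) ^ Suc n * 2 ^ (2 * Suc n + 1) * ((1 / 2 - real (n + 1)) * ?g (n + 1))"
    by (simp add: mult.left_commute)
  also have "\<dots> = real (4 * n + 2) * real (catalan n)"
    unfolding Suc.IH by (simp add: algebra_simps)
  also have "\<dots> = real (n + 2) * real (catalan (Suc n))" by (rule catalan_rec[symmetric])
  finally have "real (n + 2) * ((-1) ^ Suc n * 2 ^ (2 * Suc n + 1) * ?g (Suc n + 1)) =
      real (n + 2) * real (catalan (Suc n))" .
  moreover have "real (n + 2) \<noteq> 0" by simp
  ultimately show ?case by (metis mult_left_cancel)
qed simp

lemma catalan_Suc: "catalan (Suc n) = (\<Sum>k\<le>n. catalan k * catalan (n - k))"
proof -
  let ?g = "\<lambda>k. (1 / 2 :: real) gchoose k"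
  have split: "(\<Sum>k\<le>n + 2. f k) = f 0 + (\<Sum>k\<le>n. f (k + 1)) + f (n + 2)" for f :: "nat \<Rightarrow> real"
    by (induction n) simp_all
  \<comment> \<open>In the convolution for \<open>1/2 + 1/2 = 1\<close> the two end terms both equal
    \<open>?g (n + 2)\<close>; the inner ones are, up to sign and powers of 2, products of Catalan
    numbers.\<close>
  have "0 = (1 :: real) gchoose (n + 2)"
    by (simp add: binomial_gbinomial[of 1 "n + 2", where 'a = real, simplified, symmetric])
  also have "\<dots> = (\<Sum>k\<in>{0..n + 2}. ?g k * ?g (n + 2 - k))"
    using gbinomial_Vandermonde[of "1 / 2 :: real" "1 / 2" "n + 2"] by simp
  also have "\<dots> = 2 * ?g (n + 2) + (\<Sum>k\<le>n. ?g (k + 1) * ?g (n - k + 1))"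
    unfolding atLeast0AtMost split by (simp add: Suc_diff_le)
  finally have g: "(\<Sum>k\<le>n. ?g (k + 1) * ?g (n - k + 1)) = - 2 * ?g (n + 2)" by simp
  have "real (\<Sum>k\<le>n. catalan k * catalan (n - k)) =
      (\<Sum>k\<le>n. (-1) ^ n * 2 ^ (2 * n + 2) * (?g (k + 1) * ?g (n - k + 1)))"
  proof (unfold of_nat_sum, rule sum.cong[OF refl])
    fix k assume "k \<in> {..n}"
    then have *: "(-1) ^ k * (-1) ^ (n - k) = ((-1) ^ n :: real)"
       "2 ^ (2 * k + 1) * 2 ^ (2 * (n - k) + 1) = (2 ^ (2 * n + 2) :: real)"
      by (simp_all flip: power_add)
    then show "real (catalan k * catalan (n - k)) = (-1) ^ n * 2 ^ (2 * n + 2) * (?g (k + 1) * ?g (n - k + 1))"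
      unfolding of_nat_mult catalan_gbinomial *[symmetric] by (simp only: mult_ac)
  qed
  also have "\<dots> = real (catalan (Suc n))"
    unfolding sum_distrib_left[symmetric] g catalan_gbinomial by simp
  finally show ?thesis by (simp only: of_nat_eq_iff)
qed

lemma catalan_mono_Suc: "catalan n \<le> catalan (Suc n)"
  unfolding catalan_Suc using member_le_sum[of 0 "{..n}" "\<lambda>k. catalan k * catalan (n - k)"] by simp

text \<open>On the antidiagonal \<open>i + j = s\<close> the Catalan recurrence would give
  \<open>catalan (Suc s)\<close>; the missing term with \<open>i = 0\<close> is
  \<open>catalan s\<close>.\<close>

lemma catalan_double_sum:
  fixes x :: "'f::comm_ring_1"
  shows "(\<Sum>j=0..b. \<Sum>i=1..b + 1 - j. of_nat (catalan i * catalan j) * x ^ (i + j)) =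
    (\<Sum>s=1..b + 1. (of_nat (catalan (Suc s)) - of_nat (catalan s)) * x ^ s)"
proof (induction b)
  case 0
  have "catalan (Suc (Suc 0)) = 2" by (simp add: catalan_Suc)
  then show ?case by simp
next
  case (Suc b)
  let ?f = "\<lambda>i j. of_nat (catalan i * catalan j) * x ^ (i + j)"
  \<comment> \<open>Passing from \<open>b\<close> to \<open>Suc b\<close> adds exactly the
    antidiagonal \<open>i + j = b + 2\<close>.\<close>
  have "(\<Sum>j=0..Suc b. \<Sum>i=1..Suc b + 1 - j. ?f i j) = (\<Sum>j=0..b. (\<Sum>i=1..b + 1 - j. ?f i j) + ?f (b + 2 - j) j) + ?f 1 (Suc b)"
    by (simp add: Suc_diff_le)
  also have "\<dots> = (\<Sum>s=1..b + 1. (of_nat (catalan (Suc s)) - of_nat (catalan s)) * x ^ s)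
      + (\<Sum>j=0..Suc b. ?f (b + 2 - j) j)"
    unfolding sum.distrib Suc.IH by simp
  also have "(\<Sum>j=0..Suc b. ?f (b + 2 - j) j) = of_nat (\<Sum>j=0..Suc b. catalan (b + 2 - j) * catalan j) * x ^ (b + 2)"
    unfolding of_nat_sum sum_distrib_right by (intro sum.cong) auto
  also have "(\<Sum>j=0..Suc b. catalan (b + 2 - j) * catalan j) = (\<Sum>j\<le>b + 2. catalan j * catalan (b + 2 - j)) - catalan (b + 2)"
    by (simp add: atLeast0AtMost mult.commute)
  also have "of_nat \<dots> = (of_nat (catalan (Suc (b + 2))) - of_nat (catalan (b + 2)) :: 'f)"
    unfolding catalan_Suc[symmetric, of "b + 2"]
    by (rule of_nat_diff) (rule catalan_mono_Suc)
  finally show ?case by simp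
qed

text \<open>The coefficient of \<open>x ^ k\<close> counts the words of length \<open>k\<close> in
  which 1 is repeated, as those with a single 1 correspond to the words of length
  \<open>k - 1\<close>. Only lengths below \<open>a\<close> are collected, for which no initial rise
  can produce an occurrence.\<close>

definition catalan_diff :: "nat \<Rightarrow> 'f::comm_ring_1 \<Rightarrow> 'f" where
  "catalan_diff a x = (\<Sum>k=1..a-1. (of_nat (catalan k) - of_nat (catalan (k - 1))) * x ^ k)"

lemma catalan_diff_Suc:
  "a \<ge> 1 \<Longrightarrow> catalan_diff (Suc a) x = catalan_diff a x + (of_nat (catalan a) - of_nat (catalan (a - 1))) * x ^ a"
  by (cases a) (simp_all add: catalan_diff_def)

lemma M_fun_eq:
  assumes "a \<ge> 2"
  shows "M_fun a x u v = catalan_diff a x / ((1 - u) * (1 - v * x))"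
proof (cases "a = 2")
  case False
  then obtain b where b: "a = b + 3" using assms by (metis add.commute le_Suc_ex le_antisym nat_le_linear not_less_eq_eq numeral_2_eq_2 numeral_3_eq_3)
  have "x * (\<Sum>s=1..b + 1. (of_nat (catalan (Suc s)) - of_nat (catalan s)) * x ^ s) =
      (\<Sum>k=1..Suc (Suc b). (of_nat (catalan k) - of_nat (catalan (k - 1))) * x ^ k)"
    by (induction b) (simp_all add: algebra_simps)
  then have "x * (\<Sum>j=0..a-3. \<Sum>i=1..a-2-j. of_nat (catalan i * catalan j) * x ^ (i + j)) = catalan_diff a x"
    using catalan_double_sum[of x b] by (simp add: b catalan_diff_def)
  then show ?thesis using False by (simp add: M_fun_def)
qed (simp add: M_fun_def catalan_diff_def)

text \<open>Multiplication by \<open>1 - x\<close> turns the partial Catalan sum into differences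
  and a boundary term at \<open>x ^ a\<close>.\<close>

lemma L_fun_eq:
  assumes "a \<ge> 1" "x \<noteq> 1"
  shows "L_fun a x u = (1 + catalan_diff a x - of_nat (catalan (a - 1)) * x ^ a) / ((1 - u) * (1 - x))"
proof -
  have "(1 - x) * (\<Sum>j=0..a-1. of_nat (catalan j) * x ^ j) = 1 + catalan_diff a x - of_nat (catalan (a - 1)) * x ^ a"
    using assms(1)
  proof (induction a rule: dec_induct)
    case (step n)
    then show ?case by (cases n) (simp_all add: catalan_diff_Suc algebra_simps)
  qed (simp add: catalan_diff_def)
  then have "(\<Sum>j=0..a-1. of_nat (catalan j) * x ^ j) =
      (1 + catalan_diff a x - of_nat (catalan (a - 1)) * x ^ a) / (1 - x)"
    using assms(2) by (simp add: eq_divide_eq mult.commute)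
  then show ?thesis by (simp add: L_fun_def)
qed

text \<open>In the formulas for \<open>A(x, u)\<close> and \<open>A(x, x)\<close> the terms for
  short words thus add up to the simple fraction that solving the equations produces.\<close>

lemma M_L_cancel:
  fixes x :: "'f::field"
  assumes "a \<ge> 2" "x \<noteq> 1"
  shows "x ^ a * of_nat (catalan (a - 1)) / ((1 - u) * (1 - x)) - M_fun a x u 1 + L_fun a x u = 1 / ((1 - u) * (1 - x))"
  using assms by (simp add: M_fun_eq L_fun_eq diff_divide_distrib[symmetric] add_divide_distrib[symmetric] mult.commute)

text \<open>Of the two truncated sums, the first appears directly in the joint formula for
  \<open>a \<ge> 3\<close>, the second through the tail series.\<close>

lemma catalan_diff_eq:
  assumes "a \<ge> 2"
  shows "catalan_diff a x = (\<Sum>i=2..a-1. of_nat (catalan i) * x ^ i) - x * (\<Sum>i=1..a-2. of_nat (catalan i) * x ^ i)"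
    and "x * (\<Sum>i=2..a-1. of_nat (catalan i) * x ^ i) =
      x * (\<Sum>i=1..a-2. of_nat (catalan i) * x ^ i) + of_nat (catalan (a - 1)) * x ^ a - x ^ 2"
  using assms
proof (induction a rule: dec_induct)
  case (step n)
  obtain k where n: "n = Suc (Suc k)" using step(1) by (metis One_nat_def Suc_1 Suc_le_D Suc_le_mono)
  {
    case 1
    then show ?case using step.IH by (simp add: n catalan_diff_Suc algebra_simps)
  next
    case 2
    then show ?case using step.IH by (simp add: n algebra_simps)
  }
qed (simp_all add: catalan_diff_def power2_eq_square)

section \<open>Solving the equations for A(x, u) and A(x, x)\<close>

lemma solve_A:
  fixes x y u A Axx c R :: "'f::field"
  assumes A: "u * A * (1 - u) = u + x * y * (A - y) * (1 - u) + c * u ^ m"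
    and Axx: "x * Axx * (1 - x) = x + x * y * (Axx - y) * (1 - x) + c * x ^ m"
    and ne: "1 - u \<noteq> 0" "1 - x \<noteq> 0" "x - u \<noteq> 0" "x * y - u \<noteq> 0"
  shows "A = (x - u) / (x * y - u) * (1 / ((1 - u) * (1 - x))
     - c * (u ^ m * (1 - x) - x ^ m * (1 - u)) / ((1 - u) * (1 - x) * (x - u))
     + x * (y - 1) / (x - u) * Axx)"
proof -
  \<comment> \<open>Both equations contain \<open>x * y * y\<close>. Cross-multiplying with
    \<open>1 - x\<close> and \<open>1 - u\<close> and subtracting eliminates it in favour of
    \<open>Axx\<close>.\<close>
  have "A * (x * y - u) * ((1 - u) * (1 - x)) =
    (x - u) - c * (u ^ m * (1 - x) - x ^ m * (1 - u)) + x * (y - 1) * Axx * ((1 - u) * (1 - x))"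
  proof -
    have 1: "A * (x * y - u) * (1 - u) = x * y * y * (1 - u) - u - c * u ^ m"
      using A by (simp add: algebra_simps)
    have 2: "x * (y - 1) * Axx * (1 - x) = x * y * y * (1 - x) - x - c * x ^ m"
      using Axx by (simp add: algebra_simps)
    have "A * (x * y - u) * ((1 - u) * (1 - x)) = (A * (x * y - u) * (1 - u)) * (1 - x)"
      by (simp only: mult_ac)
    also have "\<dots> = (x - u) - c * (u ^ m * (1 - x) - x ^ m * (1 - u)) + (x * (y - 1) * Axx * (1 - x)) * (1 - u)"
      unfolding 1 2 by (simp add: algebra_simps)
    finally show ?thesis by (simp only: mult_ac)
  qed
  then have "A = ((x - u) - c * (u ^ m * (1 - x) - x ^ m * (1 - u)) + x * (y - 1) * Axx * ((1 - u) * (1 - x)))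
      / ((x * y - u) * ((1 - u) * (1 - x)))"
    using ne by (simp add: eq_divide_eq mult.assoc)
  also have "\<dots> = (x - u) / (x * y - u) * (1 / ((1 - u) * (1 - x))
     - c * (u ^ m * (1 - x) - x ^ m * (1 - u)) / ((1 - u) * (1 - x) * (x - u))
     + x * (y - 1) / (x - u) * Axx)"
    using ne by (simp add: divide_simps)
  finally show ?thesis .
qed

text \<open>After multiplication by \<open>1 - x * y\<close>, the equation of \<open>y\<close>
  replaces \<open>y * (1 - x * y)\<close>, and the common factor \<open>x * (y - 1)\<close> splits
  off and cancels.\<close>

lemma solve_Axx:
  fixes x y Axx q :: "'f::field"
  assumes m: "m \<ge> 1" and a: "a \<ge> 2"
    and Axx: "x * Axx * (1 - x) = x + x * y * (Axx - y) * (1 - x) + (q - 1) * x ^ (a - 1) * (y - 1) * x ^ m"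
    and y: "y * (1 - x * y) = 1 + (q - 1) * x ^ (a - 1) * (y - 1) * (x * y) ^ (m - 1)"
    and ne: "x \<noteq> 0" "1 - x \<noteq> 0" "y \<noteq> 1" "1 - x * y \<noteq> 0"
  shows "Axx = (q - 1) * x ^ (a - 2) * ((x * y) ^ m * (1 - x) - x ^ m * (1 - x * y)) / ((1 - x) * (1 - x * y))
    + 1 / ((1 - x * y) * (1 - x))"
proof -
  \<comment> \<open>One power of \<open>x\<close> is kept apart, so that the gain exhibits the
    factor \<open>x * (y - 1)\<close>.\<close>
  define e where "e = (q - 1) * x ^ (a - 2)"
  obtain k where k: "m = Suc k" using m by (cases m) auto
  have e: "(q - 1) * x ^ (a - 1) = x * e" using a by (cases a) (auto simp: e_def Suc_diff_Suc numeral_2_eq_2 simp flip: power_Suc)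
  have "x * (y - 1) * (Axx * ((1 - x) * (1 - x * y))) =
     x * (y - 1) * (e * ((x * y) ^ m * (1 - x) - x ^ m * (1 - x * y)) + 1)"
  proof -
    define c where "c = (q - 1) * x ^ (a - 1) * (y - 1)"
    have c: "c = x * e * (y - 1)" by (simp only: c_def e)
    have 1: "x * (y - 1) * Axx * (1 - x) = x * y * y * (1 - x) - x - c * x ^ m"
      using Axx unfolding c_def[symmetric] by (simp add: algebra_simps)
    have 2: "y * (1 - x * y) = 1 + c * (x * y) ^ k"
      using y by (simp add: c_def k)
    have "x * (y - 1) * (Axx * ((1 - x) * (1 - x * y))) = (x * (y - 1) * Axx * (1 - x)) * (1 - x * y)"
      by (simp only: mult_ac)
    also have "\<dots> = x * y * (1 - x) * (y * (1 - x * y)) - (x + c * x ^ m) * (1 - x * y)"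
      unfolding 1 by (simp add: algebra_simps)
    also have "\<dots> = x * (y - 1) + c * ((x * y) ^ m * (1 - x) - x ^ m * (1 - x * y))"
      unfolding 2 by (simp add: k algebra_simps)
    also have "\<dots> = x * (y - 1) * (e * ((x * y) ^ m * (1 - x) - x ^ m * (1 - x * y)) + 1)"
      unfolding c by (simp only: distrib_left mult_ac mult_1_left mult_1_right add_ac)
    finally show ?thesis .
  qed
  then have "Axx * ((1 - x) * (1 - x * y)) = e * ((x * y) ^ m * (1 - x) - x ^ m * (1 - x * y)) + 1"
    using ne by simp
  then have "Axx = (e * ((x * y) ^ m * (1 - x) - x ^ m * (1 - x * y)) + 1) / ((1 - x) * (1 - x * y))"
    using ne by (simp add: eq_divide_eq)
  then show ?thesis unfolding e_def[symmetric] by (simp add: add_divide_distrib mult.commute)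
qed

section \<open>Generating functions\<close>

lemma sum_NC_Suc:
  "sum f (NC (Suc n)) = (\<Sum>k\<le>n. \<Sum>\<alpha>\<in>NC k. \<Sum>\<beta>\<in>NC (n - k). f (glue \<alpha> \<beta>))"
proof -
  let ?S = "SIGMA k:{..n}. NC k \<times> NC (n - k)"
  have "bij_betw (\<lambda>(k, \<alpha>, \<beta>). glue \<alpha> \<beta>) ?S (NC (Suc n))"
    unfolding bij_betw_def
  proof (intro conjI equalityI subsetI)
    show "inj_on (\<lambda>(k, \<alpha>, \<beta>). glue \<alpha> \<beta>) ?S"
    proof (rule inj_onI)
      fix p p' assume "p \<in> ?S" "p' \<in> ?S"
        and eq: "(\<lambda>(k, \<alpha>, \<beta>). glue \<alpha> \<beta>) p = (\<lambda>(k, \<alpha>, \<beta>). glue \<alpha> \<beta>) p'"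
      obtain k \<alpha> \<beta> k' \<alpha>' \<beta>' where p: "p = (k, \<alpha>, \<beta>)" "p' = (k', \<alpha>', \<beta>')"
        by (metis prod.collapse)
      then have "\<alpha> \<in> nc_words" "\<beta> \<in> nc_words" "\<alpha>' \<in> nc_words" "\<beta>' \<in> nc_words" "k = length \<alpha>" "k' = length \<alpha>'"
        using \<open>p \<in> ?S\<close> \<open>p' \<in> ?S\<close> by (auto simp: NC_eq)
      then show "p = p'" using glue_inj[of \<alpha> \<beta> \<alpha>' \<beta>'] eq p by simp
    qed
  next
    fix w assume "w \<in> (\<lambda>(k, \<alpha>, \<beta>). glue \<alpha> \<beta>) ` ?S"
    then show "w \<in> NC (Suc n)" by (auto simp: NC_eq glue_nc_words)
  next
    fix w assume w: "w \<in> NC (Suc n)"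
    then have "w \<in> nc_words" "w \<noteq> []" by (auto simp: NC_eq)
    then obtain \<alpha> \<beta> where *: "\<alpha> \<in> nc_words" "\<beta> \<in> nc_words" "w = glue \<alpha> \<beta>"
      using glue_surj by blast
    then have "(length \<alpha>, \<alpha>, \<beta>) \<in> ?S" using w by (auto simp: NC_eq)
    then show "w \<in> (\<lambda>(k, \<alpha>, \<beta>). glue \<alpha> \<beta>) ` ?S" using *(3) by force
  qed
  then have "sum f (NC (Suc n)) = (\<Sum>(k, \<alpha>, \<beta>)\<in>?S. f (glue \<alpha> \<beta>))"
    by (simp add: sum.reindex_bij_betw[symmetric] case_prod_unfold)
  also have "\<dots> = (\<Sum>k\<le>n. \<Sum>(\<alpha>, \<beta>)\<in>NC k \<times> NC (n - k). f (glue \<alpha> \<beta>))"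
    by (subst sum.Sigma[symmetric]) (auto simp: case_prod_unfold)
  also have "\<dots> = (\<Sum>k\<le>n. \<Sum>\<alpha>\<in>NC k. \<Sum>\<beta>\<in>NC (n - k). f (glue \<alpha> \<beta>))"
    by (simp add: sum.cartesian_product)
  finally show ?thesis .
qed

lemma NC_0: "NC 0 = {[]}"
  by (auto simp: NC_eq)

lemma NC_nonempty_length: "w \<in> NC (Suc n) \<Longrightarrow> w \<noteq> []"
  by (auto simp: NC_eq)

section \<open>Recurrence for the weighted counts\<close>

lemma occurrences_shift_Nil:
  assumes "a \<ge> 2" "m \<ge> 2"
  shows "occurrences_shift (pat a m) l [] = 0"
  using occurrences_pat_upt[of a m "l + 1"] assms by (simp add: occurrences_shift_def del: upt_Suc)

lemma dist_total_0 [simp]: "dist_total a m l 0 = 1"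
  by (simp add: dist_total_def)

lemma dist_total_eq:
  assumes "a \<ge> 2" "m \<ge> 2"
  shows "dist_total a m l n = (\<Sum>w\<in>NC n. q_var ^ occurrences_shift (pat a m) l w)"
  using occurrences_shift_Nil[OF assms, of l] by (simp add: dist_total_def NC_0)

text \<open>For \<open>r = a - 1\<close> these are the words \<beta> that complete an occurrence
  together with a long enough rise before them.\<close>

definition run_total :: "nat \<Rightarrow> nat \<Rightarrow> nat \<Rightarrow> nat \<Rightarrow> qv" where
  "run_total a m r n = (\<Sum>\<beta> | \<beta> \<in> NC n \<and> take r \<beta> = replicate r 1. q_var ^ occurrences (pat a m) \<beta>)"

text \<open>One additional occurrence multiplies a weight by \<open>q\<close>, that is, adds
  \<open>q - 1\<close> times the weight. Writing it additively leaves the same product as main term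
  in all cases.\<close>

lemma weight_glue:
  assumes "a \<ge> 2" "m \<ge> 2" and \<alpha>: "\<alpha> \<in> nc_words" and \<beta>: "\<beta> \<in> nc_words"
  shows "q_var ^ occurrences_shift (pat a m) l (glue \<alpha> \<beta>) =
    q_var ^ occurrences_shift (pat a m) (Suc l) \<alpha> * q_var ^ occurrences (pat a m) \<beta> +
    (if \<alpha> = [] \<and> m - 1 \<le> l \<and> take (a - 1) \<beta> = replicate (a - 1) 1
     then (q_var - 1) * q_var ^ occurrences (pat a m) \<beta> else 0)"
proof (cases "\<beta> = []")
  case True
  then have "take (a - 1) \<beta> \<noteq> replicate (a - 1) 1" using assms(1) by auto
  moreover have "occurrences (pat a m) [] = 0" using occurrences_shift_Nil[OF assms(1,2), of 0] by simp
  ultimately show ?thesis using True by (simp add: occurrences_shift_glue_Nil)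
next
  case False
  show ?thesis
  proof (cases "\<alpha> = []")
    case True
    then show ?thesis
      using False occurrences_shift_glue_run[OF assms(1,2) \<beta> False] occurrences_shift_Nil[OF assms(1,2)]
      by (simp add: algebra_simps)
  next
    case \<alpha>': False
    then show ?thesis using occurrences_shift_glue[OF assms(1,2) \<alpha> \<alpha>' \<beta> False] by (simp add: power_add)
  qed
qed

lemma dist_total_Suc:
  assumes "a \<ge> 2" "m \<ge> 2"
  shows "dist_total a m l (Suc n) = (\<Sum>k\<le>n. dist_total a m (Suc l) k * dist_total a m 0 (n - k)) +
    (if m - 1 \<le> l then (q_var - 1) * run_total a m (a - 1) n else 0)"
proof -
  let ?t = "pat a m"
  let ?h = "\<lambda>\<beta>. if m - 1 \<le> l \<and> take (a - 1) \<beta> = replicate (a - 1) 1 then (q_var - 1) * q_var ^ occurrences ?t \<beta> else 0"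
  have "dist_total a m l (Suc n) =
      (\<Sum>k\<le>n. \<Sum>\<alpha>\<in>NC k. \<Sum>\<beta>\<in>NC (n - k). q_var ^ occurrences_shift ?t (Suc l) \<alpha> * q_var ^ occurrences ?t \<beta> +
        (if \<alpha> = [] then ?h \<beta> else 0))"
    unfolding dist_total_eq[OF assms] sum_NC_Suc
    by (intro sum.cong refl) (auto simp: NC_eq weight_glue[OF assms])
  also have "\<dots> = (\<Sum>k\<le>n. dist_total a m (Suc l) k * dist_total a m 0 (n - k)) +
      (\<Sum>k\<le>n. \<Sum>\<alpha>\<in>NC k. \<Sum>\<beta>\<in>NC (n - k). if \<alpha> = [] then ?h \<beta> else 0)"
    unfolding sum.distrib dist_total_eq[OF assms] by (simp add: sum_product)
  also have "(\<Sum>k\<le>n. \<Sum>\<alpha>\<in>NC k. \<Sum>\<beta>\<in>NC (n - k). if \<alpha> = [] then ?h \<beta> else 0) =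
      (\<Sum>k\<le>n. if k = 0 then \<Sum>\<beta>\<in>NC n. ?h \<beta> else 0)"
  proof (intro sum.cong refl)
    fix k
    show "(\<Sum>\<alpha>\<in>NC k. \<Sum>\<beta>\<in>NC (n - k). if \<alpha> = [] then ?h \<beta> else 0) = (if k = 0 then \<Sum>\<beta>\<in>NC n. ?h \<beta> else 0)"
      by (cases k) (simp_all add: NC_0 NC_nonempty_length)
  qed
  also have "\<dots> = (\<Sum>\<beta>\<in>NC n. ?h \<beta>)" by simp
  also have "\<dots> = (if m - 1 \<le> l then (q_var - 1) * run_total a m (a - 1) n else 0)"
    by (simp add: run_total_def sum_distrib_left sum.inter_filter[symmetric])
  finally show ?thesis .
qed

text \<open>Removing a leading 1 from a word that begins with two of them changes no occurrence:
  behind the empty prefix the condition \<open>m - 1 \<le> 0\<close> for a gain fails. After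
  \<open>r\<close> removals an arbitrary nonempty word remains, whence \<open>r < n\<close>.\<close>

lemma run_total_eq:
  assumes "a \<ge> 2" "m \<ge> 2"
  shows "run_total a m (Suc r) n = (if r < n then dist_total a m 0 (n - r) else 0)"
proof (induction r arbitrary: n)
  case 0
  have "take (Suc 0) \<beta> = replicate (Suc 0) 1 \<longleftrightarrow> n > 0" if "\<beta> \<in> NC n" for \<beta>
  proof (cases \<beta>)
    case (Cons b bs)
    then show ?thesis using that nc_words_hd[of \<beta>] by (auto simp: NC_eq)
  qed (use that in \<open>auto simp: NC_eq\<close>)
  then have "{\<beta>. \<beta> \<in> NC n \<and> take (Suc 0) \<beta> = replicate (Suc 0) 1} = (if n > 0 then NC n else {})"
    by auto
  then show ?case unfolding run_total_def dist_total_eq[OF assms] by simp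
next
  case (Suc r)
  show ?case
  proof (cases n)
    case 0
    have "{\<beta>. \<beta> \<in> NC 0 \<and> take (Suc (Suc r)) \<beta> = replicate (Suc (Suc r)) 1} = {}"
      by (auto simp: NC_0)
    then show ?thesis by (simp only: run_total_def 0) simp
  next
    case (Suc k)
    have eq: "{\<beta> \<in> NC (Suc k). take (Suc (Suc r)) \<beta> = replicate (Suc (Suc r)) 1} =
        glue [] ` {\<beta> \<in> NC k. take (Suc r) \<beta> = replicate (Suc r) 1}" (is "?A = ?B")
    proof (intro equalityI subsetI)
      fix w assume w: "w \<in> ?A"
      then have "w \<in> nc_words" "w \<noteq> []" by (auto simp: NC_eq)
      then obtain \<alpha> \<beta> where *: "\<alpha> \<in> nc_words" "\<beta> \<in> nc_words" "w = glue \<alpha> \<beta>"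
        using glue_surj by blast
      have "\<alpha> = []"
      proof (cases \<alpha>)
        case (Cons b bs)
        then have "b > 0" using nc_words_pos[OF *(1)] by simp
        then show ?thesis using w * Cons by (simp add: glue_def)
      qed
      then have "\<beta> \<in> NC k" "take (Suc r) \<beta> = replicate (Suc r) 1" using w * by (auto simp: NC_eq glue_Nil)
      then show "w \<in> ?B" using * \<open>\<alpha> = []\<close> by auto
    next
      fix w assume "w \<in> ?B"
      then obtain \<beta> where "w = glue [] \<beta>" "\<beta> \<in> NC k" "take (Suc r) \<beta> = replicate (Suc r) 1" by auto
      then show "w \<in> ?A" using glue_nc_words[of "[]" \<beta>] by (auto simp: NC_eq glue_Nil)
    qed
    have inj: "inj_on (glue []) X" for X by (rule inj_onI) (simp add: glue_Nil)
    have "run_total a m (Suc (Suc r)) (Suc k) = run_total a m (Suc r) k"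
      unfolding run_total_def eq sum.reindex[OF inj] o_def
    proof (rule sum.cong[OF refl])
      fix \<beta> assume "\<beta> \<in> {\<beta> \<in> NC k. take (Suc r) \<beta> = replicate (Suc r) 1}"
      then have "\<beta> \<in> nc_words" "\<beta> \<noteq> []" by (auto simp: NC_eq)
      from occurrences_shift_glue_run[OF assms this, of 0]
      show "q_var ^ occurrences (pat a m) (glue [] \<beta>) = q_var ^ occurrences (pat a m) \<beta>"
        using assms by simp
    qed
    then show ?thesis using Suc.IH[of k] Suc by simp
  qed
qed

text \<open>For \<open>n < a\<close> the gain term vanishes, and the recurrence becomes that of the
  Catalan numbers for every \<open>l\<close>.\<close>

lemma dist_total_catalan:
  assumes "a \<ge> 2" "m \<ge> 2"
  shows "n < a \<Longrightarrow> dist_total a m l n = of_nat (catalan n)"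
proof (induction n arbitrary: l rule: less_induct)
  case (less n)
  show ?case
  proof (cases n)
    case (Suc k)
    obtain r where r: "a - 1 = Suc r" using assms by (cases "a - 1") auto
    then have "k \<le> r" using less.prems Suc by linarith
    then have "run_total a m (a - 1) k = 0"
      unfolding r run_total_eq[OF assms] by simp
    then have "dist_total a m l (Suc k) = (\<Sum>i\<le>k. of_nat (catalan i) * of_nat (catalan (k - i)))"
      using less Suc by (simp add: dist_total_Suc[OF assms])
    then show ?thesis by (simp add: Suc catalan_Suc)
  qed simp
qed

text \<open>One factor \<open>x\<close> stems from the leading 1, the other \<open>a - 2\<close>
  from the ones stripped off \<beta>; subtracting 1 expresses that the remainder is
  nonempty.\<close>

definition run_gain :: "nat \<Rightarrow> nat \<Rightarrow> series_x" where
  "run_gain a m = fps_const (q_var - 1) * fps_X ^ (a - 1) * (A_xu a m $ 0 - 1)"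

lemma A_xu_rec:
  assumes "a \<ge> 2" "m \<ge> 2"
  shows "A_xu a m $ l = 1 + fps_X * (A_xu a m $ Suc l * A_xu a m $ 0) +
    (if m - 1 \<le> l then run_gain a m else 0)"
proof (rule fps_ext)
  fix n
  obtain r where r: "a - 1 = Suc r" using assms by (cases "a - 1") auto
  have g: "run_gain a m = fps_const (q_var - 1) * (fps_X * (fps_X ^ r * (A_xu a m $ 0 - 1)))"
    unfolding run_gain_def r by (simp add: mult.assoc)
  have run: "run_gain a m $ Suc k = (q_var - 1) * run_total a m (a - 1) k" for k
    unfolding g r run_total_eq[OF assms]
    by (auto simp: fps_X_power_mult_nth A_xu_def)
  show "A_xu a m $ l $ n = (1 + fps_X * (A_xu a m $ Suc l * A_xu a m $ 0) +
    (if m - 1 \<le> l then run_gain a m else 0)) $ n"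
  proof (cases n)
    case 0
    then show ?thesis by (simp add: A_xu_def g)
  next
    case (Suc k)
    have "A_xu a m $ l $ n = dist_total a m l (Suc k)" by (simp add: Suc A_xu_def)
    also have "\<dots> = (fps_X * (A_xu a m $ Suc l * A_xu a m $ 0)) $ n +
        (if m - 1 \<le> l then run_gain a m $ n else 0)"
      unfolding dist_total_Suc[OF assms] Suc run
      by (simp only: fps_X_mult_nth fps_mult_nth[of "A_xu a m $ Suc l"]) (simp add: atLeast0AtMost A_xu_def)
    finally show ?thesis by (simp add: Suc)
  qed
qed

text \<open>The geometric series, used both in \<open>x\<close> and in \<open>u\<close>.\<close>

definition ones :: "'a::comm_ring_1 fps" where "ones = Abs_fps (\<lambda>_. 1)"

lemma ones_nth [simp]: "ones $ n = 1" by (simp add: ones_def)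

lemma ones_eq: "ones = 1 + fps_X * ones"
  by (rule fps_ext) (auto)

text \<open>The recurrence multiplied by \<open>u ^ (l + 1)\<close> and summed over
  \<open>l\<close>: the shifted coefficients give \<open>A(x, u) - y\<close>, and the gain from
  \<open>l = m - 1\<close> on gives \<open>u ^ m / (1 - u)\<close>.\<close>

lemma A_xu_equation:
  assumes "a \<ge> 2" "m \<ge> 2"
  shows "fps_X * A_xu a m = fps_X * ones +
     fps_const (fps_X * A_xu a m $ 0) * (A_xu a m - fps_const (A_xu a m $ 0)) +
     fps_const (run_gain a m) * (fps_X ^ m * ones)"
proof (rule fps_ext)
  fix n
  show "(fps_X * A_xu a m) $ n = (fps_X * ones +
     fps_const (fps_X * A_xu a m $ 0) * (A_xu a m - fps_const (A_xu a m $ 0)) +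
     fps_const (run_gain a m) * (fps_X ^ m * ones)) $ n"
  proof (cases n)
    case 0
    then show ?thesis using assms by (simp add: fps_X_power_mult_nth)
  next
    case (Suc l)
    have "(fps_X * ones +
       fps_const (fps_X * A_xu a m $ 0) * (A_xu a m - fps_const (A_xu a m $ 0)) +
       fps_const (run_gain a m) * (fps_X ^ m * ones)) $ n =
       1 + fps_X * A_xu a m $ 0 * A_xu a m $ Suc l + (if m - 1 \<le> l then run_gain a m else 0)"
      using assms by (auto simp: Suc fps_X_power_mult_nth)
    then show ?thesis using A_xu_rec[OF assms, of l] by (simp add: Suc mult_ac)
  qed
qed

section \<open>Substitution of a series without constant term for u\<close>

lemma fps_power_nth_below:
  fixes w :: "'a::comm_ring_1 fps"
  assumes "w $ 0 = 0" "n < l"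
  shows "(f * w ^ l) $ n = 0"
proof -
  have "(w ^ l) $ k = 0" if "k \<le> n" for k
    using startsby_zero_power_prefix[OF assms(1)] that assms(2) by auto
  then show ?thesis by (simp add: fps_mult_nth)
qed

context
  fixes w :: series_x
  assumes w: "w $ 0 = 0"
begin

text \<open>Since \<open>w ^ l\<close> has no terms below degree \<open>l\<close>, each coefficient
  of the infinite sum is already that of a finite truncation.\<close>

lemma subst_u_nth:
  assumes "n \<le> N"
  shows "subst_u F w $ n = (\<Sum>l\<le>N. F $ l * w ^ l) $ n"
proof -
  \<comment> \<open>The candidate limit takes each coefficient from its own truncation; all longer
    partial sums agree with it there.\<close>
  define S where "S = Abs_fps (\<lambda>n. \<Sum>l\<le>n. (F $ l * w ^ l) $ n)"
  have stable: "(\<Sum>l\<in>L. (F $ l * w ^ l) $ k) = S $ k" if "{..k} \<subseteq> L" "finite L" for k L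
    unfolding S_def fps_nth_Abs_fps
    using that fps_power_nth_below[OF w] by (intro sum.mono_neutral_right) auto
  have "(\<lambda>l. F $ l * w ^ l) sums S"
    unfolding sums_def
  proof (rule tendsto_fpsI)
    fix k
    show "eventually (\<lambda>N. (\<Sum>l<N. F $ l * w ^ l) $ k = S $ k) sequentially"
      using eventually_gt_at_top[of k]
    proof eventually_elim
      case (elim N)
      then show ?case unfolding fps_sum_nth by (intro stable) auto
    qed
  qed
  then have "subst_u F w = S" unfolding subst_u_def by (rule sums_unique[symmetric])
  then show ?thesis using stable[of n "{..N}"] assms by (simp add: fps_sum_nth)
qed

lemma subst_u_eqI:
  assumes "\<And>n. \<exists>N\<ge>n. (\<Sum>l\<le>N. F $ l * w ^ l) $ n = S $ n"
  shows "subst_u F w = S"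
proof (rule fps_ext)
  fix n
  obtain N where "N \<ge> n" "(\<Sum>l\<le>N. F $ l * w ^ l) $ n = S $ n" using assms by blast
  then show "subst_u F w $ n = S $ n" using subst_u_nth[of n N F] by simp
qed

lemma subst_u_add: "subst_u (F + G) w = subst_u F w + subst_u G w"
  by (rule fps_ext) (simp add: subst_u_nth[OF order_refl] sum.distrib distrib_right)

lemma subst_u_diff: "subst_u (F - G) w = subst_u F w - subst_u G w"
  by (rule fps_ext) (simp add: subst_u_nth[OF order_refl] sum_subtractf left_diff_distrib)

lemma subst_u_const_mult: "subst_u (fps_const f * F) w = f * subst_u F w"
proof (rule fps_ext)
  fix n
  have "subst_u (fps_const f * F) w $ n = (f * (\<Sum>l\<le>n. F $ l * w ^ l)) $ n"
    by (simp add: subst_u_nth[OF order_refl] sum_distrib_left mult.assoc)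
  also have "\<dots> = (f * subst_u F w) $ n"
    by (simp add: fps_mult_nth[of f] subst_u_nth[of _ n])
  finally show "subst_u (fps_const f * F) w $ n = (f * subst_u F w) $ n" .
qed

lemma subst_u_X_mult: "subst_u (fps_X * F) w = w * subst_u F w"
proof (rule fps_ext)
  fix n
  \<comment> \<open>One term more than the degree requires, so that removing the factor
    \<open>u\<close> leaves the truncation at \<open>n\<close>.\<close>
  have "subst_u (fps_X * F) w $ n = (\<Sum>l\<le>Suc n. (fps_X * F) $ l * w ^ l) $ n"
    by (rule subst_u_nth) simp
  also have "(\<Sum>l\<le>Suc n. (fps_X * F) $ l * w ^ l) = w * (\<Sum>l\<le>n. F $ l * w ^ l)"
    unfolding sum.atMost_Suc_shift by (simp add: sum_distrib_left mult_ac)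
  also have "\<dots> $ n = (w * subst_u F w) $ n"
    by (simp add: fps_mult_nth[of w] subst_u_nth[of _ n])
  finally show "subst_u (fps_X * F) w $ n = (w * subst_u F w) $ n" .
qed

lemma subst_u_X_power_mult: "subst_u (fps_X ^ k * F) w = w ^ k * subst_u F w"
  by (induction k) (simp_all add: mult.assoc subst_u_X_mult)

lemma subst_u_const: "subst_u (fps_const f) w = f"
proof (rule subst_u_eqI)
  fix n
  show "\<exists>N\<ge>n. (\<Sum>l\<le>N. fps_const f $ l * w ^ l) $ n = f $ n"
    by (rule exI[of _ n]) (simp add: if_distrib[of "\<lambda>c. c * _"] cong: if_cong)
qed

lemma subst_u_ones: "(1 - w) * subst_u ones w = 1"
proof -
  have "subst_u ones w = subst_u (fps_const 1 + fps_X * ones) w"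
    by (simp only: fps_const_1_eq_1 ones_eq[symmetric])
  also have "\<dots> = 1 + w * subst_u ones w"
    by (simp only: subst_u_add subst_u_const subst_u_X_mult)
  finally show ?thesis by (simp add: algebra_simps)
qed

text \<open>Multiplied by \<open>1 - w\<close>, so that the identity stays in the ring of series; it
  serves for \<open>w\<close> equal to \<open>x\<close>, \<open>x * y\<close> and
  \<open>v * x\<close>.\<close>

lemma subst_u_A_xu:
  assumes "a \<ge> 2" "m \<ge> 2"
  shows "w * subst_u (A_xu a m) w * (1 - w) = w +
     fps_X * A_xu a m $ 0 * (subst_u (A_xu a m) w - A_xu a m $ 0) * (1 - w) + run_gain a m * w ^ m"
proof -
  have "w * subst_u (A_xu a m) w = w * subst_u ones w + fps_X * A_xu a m $ 0 * (subst_u (A_xu a m) w - A_xu a m $ 0) +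
      run_gain a m * (w ^ m * subst_u ones w)"
    using arg_cong[OF A_xu_equation[OF assms], of "\<lambda>F. subst_u F w"]
    by (simp only: subst_u_add subst_u_diff subst_u_const subst_u_X_mult subst_u_const_mult subst_u_X_power_mult)
  then have "w * subst_u (A_xu a m) w * (1 - w) = w * ((1 - w) * subst_u ones w) +
      fps_X * A_xu a m $ 0 * (subst_u (A_xu a m) w - A_xu a m $ 0) * (1 - w) +
      run_gain a m * (w ^ m * ((1 - w) * subst_u ones w))"
    by (simp only:) (simp add: algebra_simps)
  then show ?thesis unfolding subst_u_ones by simp
qed

end

lemma subst_u_0 [simp]: "subst_u F 0 = F $ 0"
proof (rule subst_u_eqI)
  fix n
  show "\<exists>N\<ge>n. (\<Sum>l\<le>N. F $ l * 0 ^ l) $ n = F $ 0 $ n"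
    by (rule exI[of _ n]) (simp add: power_0_left if_distrib[of "\<lambda>c. _ * c"] cong: if_cong)
qed simp

text \<open>The kernel method: at \<open>u = x * y\<close> the unknown series \<open>A(x, u)\<close> cancels.\<close>

lemma kernel_equation:
  assumes "a \<ge> 2" "m \<ge> 2"
  defines "y \<equiv> A_xu a m $ 0"
  shows "y * (1 - fps_X * y) = 1 + run_gain a m * (fps_X * y) ^ (m - 1)"
proof -
  let ?w = "fps_X * y"
  have y0: "y $ 0 = 1" by (simp add: y_def A_xu_def)
  have ne: "?w \<noteq> 0" using y0 by auto
  have "?w * subst_u (A_xu a m) ?w * (1 - ?w) = ?w + ?w * (subst_u (A_xu a m) ?w - y) * (1 - ?w) + run_gain a m * ?w ^ m"
    using subst_u_A_xu[of ?w, OF _ assms(1,2)] by (simp add: y_def)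
  moreover have "w * (y * (1 - w)) = w + g" if "w * S * (1 - w) = w + w * (S - y) * (1 - w) + g"
    for w S g :: series_x
    using that by (simp add: algebra_simps)
  ultimately have "?w * (y * (1 - ?w)) = ?w + run_gain a m * ?w ^ m" by blast
  also have "?w ^ m = ?w * ?w ^ (m - 1)" using assms by (cases m) auto
  finally have "?w * (y * (1 - ?w)) = ?w * (1 + run_gain a m * ?w ^ (m - 1))"
    by (simp only: distrib_left mult_ac mult_1_left mult_1_right)
  then show ?thesis using ne mult_left_cancel by blast
qed

section \<open>Distribution of the smallest repeated letter\<close>

lemma dist_rep_Suc:
  assumes "a \<ge> 2" "m \<ge> 2"
  shows "dist_rep a m l (Suc n) i =
    (\<Sum>\<alpha> | \<alpha> \<in> NC n \<and> (if rep \<alpha> = 0 then 0 else Suc (rep \<alpha>)) = i. q_var ^ occurrences_shift (pat a m) (Suc l) \<alpha>) +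
    (if i = 1 then dist_total a m l (Suc n) - dist_total a m (Suc l) n else 0)"
proof -
  let ?f = "\<lambda>w. q_var ^ occurrences_shift (pat a m) l w"
  \<comment> \<open>The words with a single 1. In every other nonempty word 1 is the smallest
    repeated letter, so the weight of those is a difference of totals.\<close>
  let ?E = "(\<lambda>\<alpha>. glue \<alpha> []) ` NC n"
  have E: "?E \<subseteq> NC (Suc n)" using glue_nc_words[OF _ nc_words_Nil] by (auto simp: NC_eq)
  have inj: "inj_on (\<lambda>\<alpha>. glue \<alpha> []) X" for X
    by (rule inj_onI) (simp add: glue_def inj_map_eq_map)
  have rest: "rep w = 1" if w: "w \<in> NC (Suc n) - ?E" for w
  proof -
    have "w \<in> nc_words" "w \<noteq> []" using w by (auto simp: NC_eq)
    then obtain \<alpha> \<beta> where *: "\<alpha> \<in> nc_words" "\<beta> \<in> nc_words" "w = glue \<alpha> \<beta>"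
      using glue_surj by blast
    have "\<beta> \<noteq> []" using w * by (auto simp: NC_eq)
    then show ?thesis using rep_glue * by simp
  qed
  have total: "sum ?f ?E = dist_total a m (Suc l) n"
    unfolding sum.reindex[OF inj] dist_total_eq[OF assms] by (simp add: occurrences_shift_glue_Nil)
  have "dist_rep a m l (Suc n) i = sum ?f {w \<in> ?E. rep w = i} + sum ?f {w \<in> NC (Suc n) - ?E. rep w = i}"
    unfolding dist_rep_def using E by (subst sum.union_disjoint[symmetric]) (auto intro: finite_subset intro!: arg_cong[of _ _ "sum ?f"])
  also have "{w \<in> ?E. rep w = i} = (\<lambda>\<alpha>. glue \<alpha> []) ` {\<alpha> \<in> NC n. (if rep \<alpha> = 0 then 0 else Suc (rep \<alpha>)) = i}"
    using rep_glue_Nil by (auto simp: NC_eq)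
  also have "{w \<in> NC (Suc n) - ?E. rep w = i} = (if i = 1 then NC (Suc n) - ?E else {})"
    using rest by auto
  also have "sum ?f (if i = 1 then NC (Suc n) - ?E else {}) =
      (if i = 1 then dist_total a m l (Suc n) - dist_total a m (Suc l) n else 0)"
    using sum_diff[OF finite_NC E, of ?f] total by (simp add: dist_total_eq[OF assms])
  finally show ?thesis
    unfolding sum.reindex[OF inj] by (simp add: occurrences_shift_glue_Nil)
qed

lemma dist_rep_0: "dist_rep a m l 0 (Suc i) = 0"
proof -
  have *: "{w \<in> NC 0. rep w = Suc i} = {}" by (auto simp: NC_0 rep_def)
  show ?thesis by (simp only: dist_rep_def * sum.empty)
qed

lemma dist_rep_1:
  assumes "a \<ge> 2" "m \<ge> 2"
  shows "dist_rep a m l (Suc n) 1 = dist_total a m l (Suc n) - dist_total a m (Suc l) n"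
proof -
  have *: "{\<alpha> \<in> NC n. (if rep \<alpha> = 0 then 0 else Suc (rep \<alpha>)) = 1} = {}" by auto
  show ?thesis by (simp only: dist_rep_Suc[OF assms] * sum.empty) simp
qed

lemma dist_rep_Suc_Suc:
  assumes "a \<ge> 2" "m \<ge> 2"
  shows "dist_rep a m l (Suc n) (Suc (Suc i)) = dist_rep a m (Suc l) n (Suc i)"
proof -
  have *: "{\<alpha> \<in> NC n. (if rep \<alpha> = 0 then 0 else Suc (rep \<alpha>)) = Suc (Suc i)} = {\<alpha> \<in> NC n. rep \<alpha> = Suc i}" by auto
  show ?thesis by (simp only: dist_rep_Suc[OF assms] *) (simp add: dist_rep_def)
qed

text \<open>The first letter is stripped \<open>i\<close> times: the stripped letters occur once
  each and join the initial rise, and in what remains 1 is repeated.\<close>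

lemma dist_rep_shift:
  assumes "a \<ge> 2" "m \<ge> 2"
  shows "dist_rep a m l n (Suc i) = (if i \<le> n then dist_rep a m (l + i) (n - i) 1 else 0)"
proof (induction i arbitrary: l n)
  case (Suc i)
  show ?case
    by (cases n) (simp_all add: dist_rep_0 dist_rep_Suc_Suc[OF assms] Suc)
qed simp

definition H_xu :: "nat \<Rightarrow> nat \<Rightarrow> series_xu" where
  "H_xu a m = Abs_fps (\<lambda>l. Abs_fps (\<lambda>n. dist_rep a m l n 1))"

lemma H_xu_equation:
  assumes "a \<ge> 2" "m \<ge> 2"
  shows "fps_X * H_xu a m = fps_X * A_xu a m - fps_X * ones - fps_const fps_X * (A_xu a m - fps_const (A_xu a m $ 0))"
proof -
  have "H_xu a m $ l = A_xu a m $ l - 1 - fps_X * A_xu a m $ Suc l" for l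
  proof (rule fps_ext)
    fix n
    show "H_xu a m $ l $ n = (A_xu a m $ l - 1 - fps_X * A_xu a m $ Suc l) $ n"
      by (cases n) (simp_all add: H_xu_def A_xu_def dist_rep_0[of _ _ _ 0, simplified] dist_rep_1[OF assms, simplified])
  qed
  then show ?thesis
    by (intro fps_ext) (auto simp: gr0_conv_Suc)
qed

text \<open>At \<open>u = v * x\<close> the index \<open>l\<close> counts stripped letters, each
  contributing one power of \<open>x\<close> and one of \<open>v\<close>. The result is
  \<open>A(x, 0, v)\<close> without the restrictions on \<open>n\<close> and
  \<open>i\<close>.\<close>

definition full_gf :: "nat \<Rightarrow> nat \<Rightarrow> series_x" where
  "full_gf a m = subst_u (H_xu a m) (fps_const v_var * fps_X)"

lemma full_gf_nth: "full_gf a m $ n = (\<Sum>l\<le>n. v_var ^ l * dist_rep a m l (n - l) 1)"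
proof -
  have "(H_xu a m $ l * (fps_const v_var * fps_X) ^ l) $ n = v_var ^ l * dist_rep a m l (n - l) 1" if "l \<le> n" for l
  proof -
    have eq: "H_xu a m $ l * (fps_const v_var * fps_X) ^ l = fps_const (v_var ^ l) * (fps_X ^ l * H_xu a m $ l)"
      by (simp only: power_mult_distrib fps_const_power mult_ac)
    show ?thesis unfolding eq using that by (simp add: fps_X_power_mult_nth H_xu_def)
  qed
  then show ?thesis unfolding full_gf_def by (simp add: subst_u_nth[OF _ order_refl] fps_sum_nth)
qed

text \<open>The equations of \<open>H_xu\<close> and \<open>A_xu\<close> at \<open>u = v * x\<close>
  are combined; the geometric parts cancel and the factor \<open>y - 1\<close> appears.\<close>

lemma full_gf_equation:
  assumes "a \<ge> 2" "m \<ge> 2"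
  defines "y \<equiv> A_xu a m $ 0" and "w \<equiv> fps_const v_var * fps_X"
  shows "(1 - w) * w * full_gf a m = (1 - w) * fps_X * (y - 1) * (subst_u (A_xu a m) w - y) + run_gain a m * w ^ m"
proof -
  have w0: "w $ 0 = 0" by (simp add: w_def)
  have "w * full_gf a m = w * subst_u (A_xu a m) w - w * subst_u ones w - fps_X * (subst_u (A_xu a m) w - y)"
    using arg_cong[OF H_xu_equation[OF assms(1,2)], of "\<lambda>F. subst_u F w"]
    unfolding full_gf_def w_def[symmetric] y_def
    by (simp only: subst_u_diff[OF w0] subst_u_const[OF w0] subst_u_X_mult[OF w0] subst_u_const_mult[OF w0])
  then have "(1 - w) * (w * full_gf a m) = w * subst_u (A_xu a m) w * (1 - w) - w * ((1 - w) * subst_u ones w)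
      - (1 - w) * fps_X * (subst_u (A_xu a m) w - y)"
    by (simp only:) (simp add: algebra_simps)
  then have "(1 - w) * w * full_gf a m = w * subst_u (A_xu a m) w * (1 - w) - w * ((1 - w) * subst_u ones w)
      - (1 - w) * fps_X * (subst_u (A_xu a m) w - y)"
    by (simp only: mult.assoc)
  then show ?thesis
    unfolding subst_u_A_xu[OF w0 assms(1,2)] subst_u_ones[OF w0] by (simp add: y_def algebra_simps)
qed

text \<open>The increasing word of each length contributes to \<open>1 / (1 - x)\<close>; all other
  words have a positive \<open>rep\<close>, one more than the exponent of \<open>v\<close> in
  \<open>full_gf\<close>.\<close>

lemma joint_gf_eq:
  assumes "a \<ge> 2" "m \<ge> 2"
  shows "joint_gf a m = ones + fps_const v_var * full_gf a m"
proof (rule fps_ext)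
  fix n
  have "joint_gf a m $ n = (\<Sum>w\<in>NC n. v_var ^ rep w * q_var ^ occurrences (pat a m) w)"
    by (simp add: joint_gf_def)
  \<comment> \<open>The bound \<open>Suc n\<close> makes the range left after splitting off
    \<open>i = 0\<close> match that of \<open>full_gf_nth\<close>.\<close>
  also have "\<dots> = (\<Sum>i\<le>Suc n. \<Sum>w | w \<in> NC n \<and> rep w = i. v_var ^ rep w * q_var ^ occurrences (pat a m) w)"
  proof (rule sum.group[symmetric])
    show "rep ` NC n \<subseteq> {..Suc n}" using rep_le_length by (auto simp: NC_eq le_SucI)
  qed simp_all
  also have "\<dots> = (\<Sum>i\<le>Suc n. v_var ^ i * dist_rep a m 0 n i)"
    by (intro sum.cong refl) (auto simp: dist_rep_def sum_distrib_left)
  also have "\<dots> = dist_rep a m 0 n 0 + v_var * full_gf a m $ n"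
    unfolding sum.atMost_Suc_shift full_gf_nth sum_distrib_left
    by (simp add: dist_rep_shift[OF assms, of 0 n] mult.assoc)
  also have "dist_rep a m 0 n 0 = 1"
  proof -
    have "set (take k [1..<n + 1]) = {1..min k n}" for k
      by (cases "k \<le> n") (auto simp: take_upt simp del: upt_Suc)
    moreover have "non_crossing [1..<n + 1]"
      by (auto simp: non_crossing_def simp del: upt_Suc)
    ultimately have "[1..<n + 1] \<in> nc_words" unfolding nc_words_def by blast
    then have "{w \<in> NC n. rep w = 0} = {[1..<n + 1]}"
      using rep_eq_0_iff by (auto simp: NC_eq simp del: upt_Suc)
    then show ?thesis using occurrences_pat_upt[of a m "n + 1"] assms
      by (simp add: dist_rep_def del: upt_Suc)
  qed
  finally show "joint_gf a m $ n = (ones + fps_const v_var * full_gf a m) $ n" by simp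
qed

text \<open>\<open>A_xuv\<close> keeps the terms with \<open>n - l \<ge> a\<close>. In the others
  fewer than \<open>a\<close> letters follow the rise, so nothing occurs and the weight is a
  difference of Catalan numbers; together they form \<open>M(x, 0, v)\<close>.\<close>

lemma full_gf_A_xuv:
  assumes "a \<ge> 2" "m \<ge> 2"
  shows "full_gf a m = A_xuv a m $ 0 + catalan_diff a fps_X * Abs_fps (\<lambda>n. v_var ^ n)"
proof (rule fps_ext)
  fix n
  let ?d = "\<lambda>l. v_var ^ l * dist_rep a m l (n - l) 1"
  have A: "A_xuv a m $ 0 $ n = sum ?d {l. l + a \<le> n}"
  proof (cases "n \<ge> a")
    case True
    have "A_xuv a m $ 0 $ n = (\<Sum>i=1..n-a+1. dist_rep a m 0 n i * v_var ^ (i - 1))"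
      using True by (simp add: A_xuv_def)
    also have "\<dots> = (\<Sum>l\<in>{..n-a}. dist_rep a m 0 n (Suc l) * v_var ^ l)"
      by (rule sum.reindex_bij_witness[of _ Suc "\<lambda>i. i - 1"]) auto
    also have "\<dots> = sum ?d {..n-a}"
      by (rule sum.cong) (auto simp: dist_rep_shift[OF assms, of 0 n])
    also have "{..n-a} = {l. l + a \<le> n}" using True by auto
    finally show ?thesis .
  next
    case False
    then have "{l. l + a \<le> n} = {}" by auto
    then show ?thesis using False by (simp add: A_xuv_def)
  qed
  have P: "catalan_diff a fps_X $ k = dist_rep a m l k 1" if "k < a" for k l
  proof (cases k)
    case 0
    then show ?thesis using dist_rep_0[of a m l 0]
      by (auto simp: catalan_diff_def fps_sum_nth fps_mult_nth intro!: sum.neutral)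
  next
    case (Suc i)
    have "catalan_diff a fps_X $ k = (\<Sum>j=1..a-1. if j = k then of_nat (catalan j) - of_nat (catalan (j - 1)) else (0::qv))"
      unfolding catalan_diff_def fps_sum_nth
      by (intro sum.cong refl) (simp add: fps_of_nat[symmetric] del: fps_of_nat)
    also have "\<dots> = of_nat (catalan k) - of_nat (catalan (k - 1))"
    proof -
      have "k \<in> {1..a-1}" using that Suc by auto
      then show ?thesis by simp
    qed
    also have "\<dots> = dist_rep a m l k 1"
      using that Suc dist_total_catalan[OF assms] dist_rep_1[OF assms, of l i] by simp
    finally show ?thesis .
  qed
  have P0: "catalan_diff a fps_X $ k = (0::qv)" if "k \<ge> a" for k
    unfolding catalan_diff_def fps_sum_nth
    using that assms by (intro sum.neutral) (auto simp: fps_of_nat[symmetric] simp del: fps_of_nat)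
  have "full_gf a m $ n = sum ?d {..n}" by (rule full_gf_nth)
  also have "\<dots> = sum ?d {l. l + a \<le> n} + sum ?d {l. l \<le> n \<and> n < l + a}"
    by (subst sum.union_disjoint[symmetric]) (auto intro: finite_subset[of _ "{..n}"] intro!: sum.cong)
  also have "sum ?d {l. l \<le> n \<and> n < l + a} = (\<Sum>l\<le>n. v_var ^ l * catalan_diff a fps_X $ (n - l))"
  proof (rule sum.mono_neutral_cong_left)
    show "\<forall>l\<in>{..n} - {l. l \<le> n \<and> n < l + a}. v_var ^ l * catalan_diff a fps_X $ (n - l) = 0"
      using P0 by auto
    show "?d l = v_var ^ l * catalan_diff a fps_X $ (n - l)" if "l \<in> {l. l \<le> n \<and> n < l + a}" for l
    proof -
      have "n - l < a" using that by simp linarith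
      then show ?thesis using P[of "n - l" l] by metis
    qed
  qed auto
  also have "\<dots> = (Abs_fps (\<lambda>n. v_var ^ n) * catalan_diff a fps_X) $ n"
    by (simp add: fps_mult_nth atLeast0AtMost)
  finally show "full_gf a m $ n = (A_xuv a m $ 0 + catalan_diff a fps_X * Abs_fps (\<lambda>n. v_var ^ n)) $ n"
    by (simp add: A mult.commute)
qed

lemma v_geometric: "(1 - fps_const v_var * fps_X) * Abs_fps (\<lambda>n. v_var ^ n) = 1"
proof (rule fps_ext)
  fix n
  show "((1 - fps_const v_var * fps_X) * Abs_fps (\<lambda>n. v_var ^ n)) $ n = 1 $ n"
    by (cases n) (simp_all add: left_diff_distrib mult.assoc)
qed

text \<open>The range of \<open>j\<close> says that \<open>k = n - j\<close> runs from 1 to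
  \<open>a - 2\<close> while \<open>j \<ge> 1\<close>, so the series is a Catalan polynomial times
  \<open>v * x / (1 - v * x)\<close>.\<close>

lemma tail_series_eq:
  assumes "a \<ge> 3"
  shows "tail_series a = (\<Sum>k=1..a-2. of_nat (catalan k) * fps_X ^ k) * (fps_const v_var * fps_X * Abs_fps (\<lambda>n. v_var ^ n))"
    (is "_ = ?Q * ?V")
proof (rule fps_ext)
  fix n
  have V: "?V $ j = (if j = 0 then 0 else v_var ^ j)" for j
    by (cases j) (simp_all add: mult.assoc)
  have Q: "?Q $ k = (if k \<in> {1..a-2} then of_nat (catalan k) else 0)" for k
  proof -
    have "?Q $ k = (\<Sum>j=1..a-2. if j = k then of_nat (catalan j) else (0::qv))"
      unfolding fps_sum_nth by (intro sum.cong refl) (simp add: fps_of_nat[symmetric] del: fps_of_nat)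
    then show ?thesis by simp
  qed
  have "(?Q * ?V) $ n = (\<Sum>j\<le>n. ?V $ j * ?Q $ (n - j))"
    unfolding mult.commute[of ?Q] fps_mult_nth[of ?V] atLeast0AtMost ..
  also have "\<dots> = (\<Sum>j\<in>(if n \<ge> 2 then {max 1 (n + 2 - a)..n-1} else {}). of_nat (catalan (n - j)) * v_var ^ j)"
  proof (rule sum.mono_neutral_cong_right)
    show "\<forall>j\<in>{..n} - (if n \<ge> 2 then {max 1 (n + 2 - a)..n-1} else {}). ?V $ j * ?Q $ (n - j) = 0"
      unfolding V Q using assms by auto
    show "?V $ j * ?Q $ (n - j) = of_nat (catalan (n - j)) * v_var ^ j"
      if "j \<in> (if n \<ge> 2 then {max 1 (n + 2 - a)..n-1} else {})" for j
      unfolding V Q using that assms by (auto split: if_splits)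
  qed (auto split: if_splits)
  also have "\<dots> = tail_series a $ n" by (simp add: tail_series_def)
  finally show "tail_series a $ n = (?Q * ?V) $ n" ..
qed

section \<open>Passage to the field of fractions\<close>

lemma of_series_x_0: "of_series_x 0 = 0"
  and of_series_x_1: "of_series_x 1 = 1"
  and of_series_x_add: "of_series_x (f + g) = of_series_x f + of_series_x g"
  and of_series_x_diff: "of_series_x (f - g) = of_series_x f - of_series_x g"
  and of_series_x_mult: "of_series_x (f * g) = of_series_x f * of_series_x g"
  and of_series_x_eq_0_iff: "of_series_x f = 0 \<longleftrightarrow> f = 0"
  by (simp_all add: of_series_x_def flip: to_fract_add to_fract_diff to_fract_mult)

lemma of_series_x_power: "of_series_x (f ^ n) = of_series_x f ^ n"
  by (induction n) (simp_all add: of_series_x_1 of_series_x_mult)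

lemma of_series_x_of_nat: "of_series_x (of_nat n) = of_nat n"
  by (induction n) (simp_all add: of_series_x_0 of_series_x_1 of_series_x_add)

lemma of_series_x_sum: "of_series_x (sum f I) = (\<Sum>i\<in>I. of_series_x (f i))"
  by (induction I rule: infinite_finite_induct) (simp_all add: of_series_x_0 of_series_x_add)

lemmas of_series_x_hom = of_series_x_0 of_series_x_1 of_series_x_add of_series_x_diff of_series_x_mult
  of_series_x_power of_series_x_of_nat of_series_x_sum

lemma to_fract_power: "to_fract (f ^ n) = to_fract f ^ n"
  by (induction n) simp_all

theorem theorem10:
  fixes a m :: nat
  assumes "a \<ge> 2" and "m \<ge> 2"
  shows
    "let x = of_series_x fps_X;
         u = to_fract fps_X;
         q = of_series_x (fps_const q_var);
         v = of_series_x (fps_const v_var);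
         C = (\<lambda>j. of_nat (catalan j));
         M = M_fun a;
         L = L_fun a;
         A = to_fract (A_xu a m);
         y = of_series_x (subst_u (A_xu a m) 0);
         Axx = of_series_x (subst_u (A_xu a m) fps_X);
         Axvx = of_series_x (subst_u (A_xu a m) (fps_const v_var * fps_X));
         Ax0v = of_series_x (subst_u (A_xuv a m) 0)
     in y = of_series_x (occ_gf a m) \<and>
        x * y ^ 2 - y + 1 + (q - 1) * x ^ (a + m - 2) * y ^ (m - 1) * (y - 1) = 0 \<and>
        (a = 2 \<longrightarrow> of_series_x (joint_gf a m) = v * Ax0v + 1 / (1 - x)) \<and>
        (a \<ge> 3 \<longrightarrow> of_series_x (joint_gf a m) =
           v * Ax0v + 1 / (1 - x)
           + (v ^ 2 * x ^ a * C (a - 1) - v ^ 2 * x ^ 2) / (1 - v * x)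
           + v * (\<Sum>i=2..a-1. C i * x ^ i)
           + (v - 1) * of_series_x (tail_series a)) \<and>
        Ax0v = (y - 1) * (Axvx - y) / v - M x 0 v
           + (q - 1) * v ^ (m - 1) * x ^ (a + m - 2) * (y - 1) / (1 - v * x) \<and>
        A = (x - u) / (x * y - u) *
           (x ^ a * C (a - 1) / ((1 - u) * (1 - x))
            + (1 - q) * x ^ (a - 1) * (u ^ m * (1 - x) - x ^ m * (1 - u)) * (y - 1)
                / ((1 - u) * (1 - x) * (x - u))
            + x * (y - 1) / (x - u) * Axx
            - M x u 1 + L x u) \<and>
        Axx = (q - 1) * x ^ (a - 2) * ((x * y) ^ m * (1 - x) - x ^ m * (1 - x * y))
                / ((1 - x) * (1 - x * y))
           - M x (x * y) 1
           + x ^ a * C (a - 1) / ((1 - x) * (1 - x * y))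
           + L x (x * y)"
proof -
  define Y where "Y = A_xu a m $ 0"
  define x where "x = of_series_x fps_X"
  define u :: frac_xu where "u = to_fract fps_X"
  define q where "q = of_series_x (fps_const q_var)"
  define v where "v = of_series_x (fps_const v_var)"
  define A where "A = to_fract (A_xu a m)"
  define y where "y = of_series_x (subst_u (A_xu a m) 0)"
  define Axx where "Axx = of_series_x (subst_u (A_xu a m) fps_X)"
  define Axvx where "Axvx = of_series_x (subst_u (A_xu a m) (fps_const v_var * fps_X))"
  define Ax0v where "Ax0v = of_series_x (subst_u (A_xuv a m) 0)"
  define F where "F = of_series_x (full_gf a m)"
  define c where "c = of_series_x (run_gain a m)"
  define S where "S = (\<Sum>i=2..a-1. of_nat (catalan i) * x ^ i)"
  define T where "T = (\<Sum>i=1..a-2. of_nat (catalan i) * x ^ i)"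
  define V where "V = of_series_x (Abs_fps (\<lambda>n. v_var ^ n))"
  have y_eq: "y = of_series_x Y" by (simp add: y_def Y_def)
  have q1: "of_series_x (fps_const (q_var - 1)) = q - 1"
    unfolding q_def of_series_x_1[symmetric] of_series_x_diff[symmetric]
    by (simp only: fps_const_sub[symmetric] fps_const_1_eq_1)
  have c: "c = (q - 1) * x ^ (a - 1) * (y - 1)"
    by (simp add: c_def run_gain_def of_series_x_hom q1 x_def y_eq Y_def)
  have const: "of_series_x f = to_fract (fps_const f)" for f by (simp add: of_series_x_def)

  have Y0: "Y $ 0 = 1" by (simp add: Y_def A_xu_def)
  have Y1: "Y $ 1 = 1"
    \<comment> \<open>This coefficient shows below that \<open>y\<close> is not 1, which permits
      cancelling \<open>y - 1\<close>.\<close>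
    using dist_total_catalan[OF assms, of 1 0] assms by (simp add: Y_def A_xu_def)
  have x0: "x \<noteq> 0" by (simp add: x_def of_series_x_eq_0_iff)
  have v0: "v \<noteq> 0" by (simp add: v_def of_series_x_eq_0_iff v_var_def)
  have nth_ne: "f \<noteq> g" if "f $ n \<noteq> g $ n" for f g :: "'b::zero fps" and n using that by auto
  have u1: "1 - u \<noteq> 0"
    unfolding u_def to_fract_1[symmetric] to_fract_diff[symmetric] to_fract_eq_0_iff
    by (rule nth_ne[of _ 0]) simp
  have x1: "1 - x \<noteq> 0"
    unfolding x_def of_series_x_1[symmetric] of_series_x_diff[symmetric] of_series_x_eq_0_iff
    by (rule nth_ne[of _ 0]) simp
  have xy1: "1 - x * y \<noteq> 0"
    unfolding x_def y_eq of_series_x_1[symmetric] of_series_x_mult[symmetric] of_series_x_diff[symmetric] of_series_x_eq_0_iff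
    by (rule nth_ne[of _ 0]) simp
  have vx1: "1 - v * x \<noteq> 0"
    unfolding x_def v_def of_series_x_1[symmetric] of_series_x_mult[symmetric] of_series_x_diff[symmetric] of_series_x_eq_0_iff
    by (rule nth_ne[of _ 0]) simp
  have y1: "y \<noteq> 1"
  proof -
    have "Y - 1 \<noteq> 0" by (rule nth_ne[of _ 1]) (simp add: Y1 del: One_nat_def)
    then have "y - 1 \<noteq> 0"
      unfolding y_eq of_series_x_1[symmetric] of_series_x_diff[symmetric] of_series_x_eq_0_iff .
    then show ?thesis by simp
  qed
  \<comment> \<open>Index 1 refers to the power of \<open>u\<close> here: \<open>x\<close> and
    \<open>y\<close> are constant in \<open>u\<close>.\<close>
  have xyu: "x * y - u \<noteq> 0"
    unfolding x_def y_eq u_def of_series_x_mult[symmetric]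
    unfolding const to_fract_diff[symmetric] to_fract_eq_0_iff
    by (rule nth_ne[of _ 1]) simp
  have xu: "x - u \<noteq> 0"
    unfolding x_def u_def const to_fract_diff[symmetric] to_fract_eq_0_iff
    by (rule nth_ne[of _ 1]) simp

  have A_eq: "u * A * (1 - u) = u + x * y * (A - y) * (1 - u) + c * u ^ m"
  proof -
    have ones: "(1 - fps_X) * ones = (1 :: series_xu)"
    proof -
      have "(1 - fps_X) * ones = ones - fps_X * (ones :: series_xu)" by (simp add: algebra_simps)
      also have "\<dots> = 1" by (subst (1) ones_eq) simp
      finally show ?thesis .
    qed
    have "fps_X * A_xu a m * (1 - fps_X) = fps_X * ((1 - fps_X) * ones) +
      fps_const (fps_X * Y) * (A_xu a m - fps_const Y) * (1 - fps_X) +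
      fps_const (run_gain a m) * fps_X ^ m * ((1 - fps_X) * ones)"
      unfolding A_xu_equation[OF assms] Y_def[symmetric] by (simp only: ring_distribs mult_ac)
    then have "to_fract (fps_X * A_xu a m * (1 - fps_X)) = to_fract (fps_X +
      fps_const (fps_X * Y) * (A_xu a m - fps_const Y) * (1 - fps_X) + fps_const (run_gain a m) * fps_X ^ m)"
      unfolding ones by simp
    then show ?thesis
      by (simp add: to_fract_power const[symmetric] of_series_x_mult u_def A_def x_def y_eq c_def
          del: fps_const_mult)
  qed
  have Axx_eq: "x * Axx * (1 - x) = x + x * y * (Axx - y) * (1 - x) + c * x ^ m"
    using arg_cong[OF subst_u_A_xu[of fps_X, OF _ assms], of of_series_x]
    by (simp add: of_series_x_hom x_def Axx_def y_eq c_def Y_def)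
  have y_kernel: "y * (1 - x * y) = 1 + c * (x * y) ^ (m - 1)"
    using arg_cong[OF kernel_equation[OF assms], of of_series_x]
    by (simp add: of_series_x_hom x_def y_eq c_def Y_def)
  have F_eq: "(1 - v * x) * (v * x) * F = (1 - v * x) * x * (y - 1) * (Axvx - y) + c * (v * x) ^ m"
    using arg_cong[OF full_gf_equation[OF assms], of of_series_x]
    by (simp add: of_series_x_hom x_def v_def y_eq c_def Y_def F_def Axvx_def)
  have V: "V = 1 / (1 - v * x)"
    using arg_cong[OF v_geometric, of of_series_x] vx1
    by (simp add: of_series_x_hom x_def v_def V_def eq_divide_eq mult.commute)
  have catalan_diff: "of_series_x (catalan_diff a fps_X) = catalan_diff a x"
    by (simp add: catalan_diff_def of_series_x_hom x_def)
  have F_A: "F = Ax0v + catalan_diff a x / (1 - v * x)"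
    using arg_cong[OF full_gf_A_xuv[OF assms], of of_series_x] V
    by (simp add: of_series_x_hom F_def Ax0v_def V_def catalan_diff)
  have ones: "of_series_x ones = 1 / (1 - x)"
  proof -
    have "of_series_x ones * (1 - x) = 1"
      using arg_cong[OF ones_eq, of of_series_x] by (simp add: of_series_x_hom x_def algebra_simps)
    then show ?thesis using x1 by (simp add: eq_divide_eq)
  qed
  have joint: "of_series_x (joint_gf a m) = v * Ax0v + 1 / (1 - x) + v * (catalan_diff a x / (1 - v * x))"
    using arg_cong[OF joint_gf_eq[OF assms], of of_series_x] F_A
    by (simp add: of_series_x_hom ones v_def F_def algebra_simps)
  have pow: "x ^ (a - 1) * x ^ (m - 1) = x ^ (a + m - 2)"
  proof -
    have "a - 1 + (m - 1) = a + m - 2" using assms by linarith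
    then show ?thesis by (simp only: power_add[symmetric])
  qed
  have pow_m: "z ^ m = z * z ^ (m - 1)" for z :: frac_xu using assms by (cases m) auto

  have 1: "y = of_series_x (occ_gf a m)"
  proof -
    have "Y = occ_gf a m"
      by (rule fps_ext) (simp add: Y_def A_xu_def occ_gf_def dist_total_eq[OF assms])
    then show ?thesis by (simp add: y_eq)
  qed
  have 2: "x * y ^ 2 - y + 1 + (q - 1) * x ^ (a + m - 2) * y ^ (m - 1) * (y - 1) = 0"
  proof -
    have "(q - 1) * x ^ (a + m - 2) * y ^ (m - 1) * (y - 1) = c * (x * y) ^ (m - 1)"
      unfolding c pow[symmetric] power_mult_distrib by (simp only: mult_ac)
    then show ?thesis using y_kernel by (simp add: algebra_simps power2_eq_square)
  qed
  have 3: "of_series_x (joint_gf a m) = v * Ax0v + 1 / (1 - x)" if "a = 2"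
    using joint that by (simp add: catalan_diff_def)
  have 4: "of_series_x (joint_gf a m) = v * Ax0v + 1 / (1 - x)
      + (v ^ 2 * x ^ a * of_nat (catalan (a - 1)) - v ^ 2 * x ^ 2) / (1 - v * x)
      + v * S + (v - 1) * of_series_x (tail_series a)" if "a \<ge> 3"
  proof -
    have tail: "of_series_x (tail_series a) = T * (v * x * V)"
      using arg_cong[OF tail_series_eq[OF that], of of_series_x]
      by (simp add: of_series_x_hom T_def V_def x_def v_def)
    have P: "catalan_diff a x = S - x * T"
      and S: "x * S = x * T + of_nat (catalan (a - 1)) * x ^ a - x ^ 2"
      unfolding S_def T_def using catalan_diff_eq[OF assms(1), of x] by blast+
    \<comment> \<open>\<open>v ^ 2 * (x * S)\<close> is added and subtracted, once in the form given
      by the telescoping identity \<open>S\<close>; the multiples of \<open>T\<close> then combine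
      to the numerator of the tail series.\<close>
    have "v * catalan_diff a x = (v ^ 2 * x ^ a * of_nat (catalan (a - 1)) - v ^ 2 * x ^ 2)
      + v * S * (1 - v * x) + (v - 1) * (T * (v * x))"
    proof -
      have "v * S * (1 - v * x) = v * S - v ^ 2 * (x * S)" by (simp add: algebra_simps power2_eq_square)
      then show ?thesis unfolding S P by (simp add: algebra_simps power2_eq_square)
    qed
    then have "v * (catalan_diff a x / (1 - v * x)) = ((v ^ 2 * x ^ a * of_nat (catalan (a - 1)) - v ^ 2 * x ^ 2)
      + v * S * (1 - v * x) + (v - 1) * (T * (v * x))) / (1 - v * x)"
      by simp
    also have "\<dots> = (v ^ 2 * x ^ a * of_nat (catalan (a - 1)) - v ^ 2 * x ^ 2) / (1 - v * x)
      + v * S + (v - 1) * of_series_x (tail_series a)"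
      unfolding tail V using vx1 by (simp add: add_divide_distrib)
    finally show ?thesis unfolding joint by (simp only: add.assoc)
  qed
  have 5: "Ax0v = (y - 1) * (Axvx - y) / v - M_fun a x 0 v
     + (q - 1) * v ^ (m - 1) * x ^ (a + m - 2) * (y - 1) / (1 - v * x)"
  proof -
    \<comment> \<open>An additional factor \<open>v\<close> makes \<open>v * x\<close> common to all
      terms; it accounts for the division by \<open>v\<close> in the result.\<close>
    have "(v * x) * ((1 - v * x) * (v * F)) = (v * x) * ((1 - v * x) * (y - 1) * (Axvx - y) + v * (c * (v * x) ^ (m - 1)))"
      using arg_cong[OF F_eq, of "\<lambda>z. v * z"] unfolding pow_m[of "v * x"] by (simp add: ring_distribs mult_ac)
    then have "(1 - v * x) * (v * F) = (1 - v * x) * (y - 1) * (Axvx - y) + v * (c * (v * x) ^ (m - 1))"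
      using v0 x0 by simp
    then have "F = (y - 1) * (Axvx - y) / v + c * (v * x) ^ (m - 1) / (1 - v * x)"
      using v0 vx1 by (simp add: field_simps)
    moreover have "c * (v * x) ^ (m - 1) = (q - 1) * v ^ (m - 1) * x ^ (a + m - 2) * (y - 1)"
      unfolding c pow[symmetric] power_mult_distrib by (simp only: mult_ac)
    ultimately show ?thesis unfolding M_fun_eq[OF assms(1)] using F_A by (simp add: algebra_simps)
  qed
  have cancel: "x ^ a * of_nat (catalan (a - 1)) / ((1 - z) * (1 - x)) - M_fun a x z 1 + L_fun a x z = 1 / ((1 - z) * (1 - x))" for z
    by (rule M_L_cancel) (use assms x1 in auto)
  have 6: "A = (x - u) / (x * y - u) *
     (x ^ a * of_nat (catalan (a - 1)) / ((1 - u) * (1 - x))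
      + (1 - q) * x ^ (a - 1) * (u ^ m * (1 - x) - x ^ m * (1 - u)) * (y - 1)
          / ((1 - u) * (1 - x) * (x - u))
      + x * (y - 1) / (x - u) * Axx
      - M_fun a x u 1 + L_fun a x u)"
  proof -
    let ?W = "u ^ m * (1 - x) - x ^ m * (1 - u)"
    have *: "(1 - q) * x ^ (a - 1) * ?W * (y - 1) = - (c * ?W)"
      unfolding c by (simp add: algebra_simps)
    have "A = (x - u) / (x * y - u) * (1 / ((1 - u) * (1 - x))
        - c * ?W / ((1 - u) * (1 - x) * (x - u)) + x * (y - 1) / (x - u) * Axx)"
      by (rule solve_A[OF A_eq Axx_eq u1 x1 xu xyu])
    \<comment> \<open>An abstract identity keeps the large fractions opaque while they are
      rearranged.\<close>
    moreover have "r - w / d + z = p + n / d + z - k + l"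
      if "p - k + l = r" "n = - w" for p k l r n w z d :: frac_xu
      using that by auto
    ultimately show ?thesis using cancel[of u] * by metis
  qed
  have 7: "Axx = (q - 1) * x ^ (a - 2) * ((x * y) ^ m * (1 - x) - x ^ m * (1 - x * y))
          / ((1 - x) * (1 - x * y))
     - M_fun a x (x * y) 1
     + x ^ a * of_nat (catalan (a - 1)) / ((1 - x) * (1 - x * y))
     + L_fun a x (x * y)"
  proof -
    have "m \<ge> 1" using assms by simp
    note Axx = solve_Axx[OF this assms(1) Axx_eq[unfolded c] y_kernel[unfolded c] x0 x1 y1 xy1]
    have "n + r = n - k + p + l" if "p - k + l = r" for p k l r n :: frac_xu
      using that by auto
    from this[OF cancel[of "x * y"]] show ?thesis
      unfolding mult.commute[of "1 - x" "1 - x * y"] by (rule trans[OF Axx[unfolded mult.commute[of "1 - x" "1 - x * y"]]])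
  qed
  show ?thesis
    unfolding Let_def x_def[symmetric] u_def[symmetric] q_def[symmetric] v_def[symmetric] A_def[symmetric]
      y_def[symmetric] Axx_def[symmetric] Axvx_def[symmetric] Ax0v_def[symmetric] S_def[symmetric]
    by (intro conjI impI) (fact 1, fact 2, erule 3, erule 4, fact 5, fact 6, fact 7)
qed

end
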